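(* Let $\mathbf\Xi\subset\mathbb R^p$ be compact and equipped with a probability measure $\rho$. Let $u_0\in\mathcal L^\infty(\mathbf\Xi;\mathcal L^\infty(\mathbb R^n))$ and let the flux $\mathbf f:\mathbb R\times\mathbf\Xi\to\mathbb R^n$ satisfy: (i) for every compact $K\subset\mathbb R$ there exists $C_K\in\mathbb R$ such that for all $w\in K$ and $\rho$-almost every $\bm\xi$, $\Vert\mathbf f(w,\bm\xi)\Vert\le C_K$; (ii) for $\rho$-almost every $\bm\xi$, $\mathbf f(\cdot,\bm\xi)\in\mathcal C^1(\mathbb R;\mathbb R^n)$. Let $u:\mathbb R_+\times\mathbb R^n\times\mathbf\Xi\to\mathbb R$ be a function such that $\bm\xi\mapsto u(\cdot,\cdot,\bm\xi)$ is Bochner measurable (as a map from $\mathbf\Xi$ to $\mathcal L^\infty(\mathbb R_+\times\mathbb R^n)$). Then $u$ is a parametric entropy solution for the Kruzhkov family $\mathcal E_K$ if and only if $u$ is a weak-parametric entropy solution for the Kruzhkov family $\mathcal E_K$ (both with initial data $u_0$ and flux $\mathbf f$).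
   Context: The underlying problem is the parameter-dependent scalar conservation law $\partial_t u(t,\mathbf x,\bm\xi)+\mathrm{div}_{\mathbf x}\,\mathbf f(u(t,\mathbf x,\bm\xi),\bm\xi)=0$ on $\mathbb R_+\times\mathbb R^n\times\mathbf\Xi$, with $u(0,\mathbf x,\bm\xi)=u_0(\mathbf x,\bm\xi)$. Here $\mathbb R_+=[0,\infty)$; $\mathbb R_+$ and $\mathbb R^n$ carry Lebesgue measure and $\mathbf\Xi$ carries $\rho$. $\mathcal C^1_c(\mathbb R_+\times\mathbb R^n)$ denotes continuously differentiable functions with compact support in $\mathbb R_+\times\mathbb R^n$ (not required to vanish at $t=0$). Kruzhkov family of entropy pairs: $\mathcal E_K:=\{(\eta_v,\mathbf q_v):v\in\mathbb R\}$, where for all $v,w\in\mathbb R$ and $\rho$-almost all $\bm\xi$, $\eta_v(w):=|w-v|$ and $\mathbf q_v(w,\bm\xi):=\mathrm{sign}(w-v)\,(\mathbf f(w,\bm\xi)-\mathbf f(v,\bm\xi))$. Parametric entropy solution for $\mathcal E_K$: a function $u:\mathbb R_+\times\mathbb R^n\times\mathbf\Xi\to\mathbb R$ such that $u(\cdot,\cdot,\bm\xi)\in\mathcal L^\infty(\mathbb R_+\times\mathbb R^n)$ for $\rho$-almost all $\bm\xi$ and such that, for all $(\eta,\mathbf q)\in\mathcal E_K$, for all non-negative $\psi\in\mathcal C^1_c(\mathbb R_+\times\mathbb R^n)$ and $\rho$-almost all $\bm\xi$, $$\int_{\mathbb R_+}\int_{\mathbb R^n}\big(\partial_t\psi(t,\mathbf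 x)\,\eta(u(t,\mathbf x,\bm\xi))+\nabla_{\mathbf x}\psi(t,\mathbf x)\cdot\mathbf q(u(t,\mathbf x,\bm\xi),\bm\xi)\big)\,d\mathbf x\,dt+\int_{\mathbb R^n}\psi(0,\mathbf x)\,\eta(u_0(\mathbf x,\bm\xi))\,d\mathbf x\ge 0.$$ Weak-parametric entropy solution for $\mathcal E_K$: a measurable function $u:\mathbb R_+\times\mathbb R^n\times\mathbf\Xi\to\mathbb R$ in $\mathcal L^\infty(\mathbb R_+\times\mathbb R^n\times\mathbf\Xi)$ such that, for all $(\eta,\mathbf q)\in\mathcal E_K$ and all non-negative $\phi\in\mathcal C(\mathbf\Xi;\mathcal C^1_c(\mathbb R_+\times\mathbb R^n))$, $$\int_{\mathbb R_+}\int_{\mathbb R^n}\int_{\mathbf\Xi}\big(\partial_t\phi(t,\mathbf x,\bm\xi)\,\eta(u(t,\mathbf x,\bm\xi))+\nabla_{\mathbf x}\phi(t,\mathbf x,\bm\xi)\cdot\mathbf q(u(t,\mathbf x,\bm\xi),\bm\xi)\big)\,d\rho(\bm\xi)\,d\mathbf x\,dt+\int_{\mathbb R^n}\int_{\mathbf\Xi}\phi(0,\mathbf x,\bm\xi)\,\eta(u_0(\mathbf x,\bm\xi))\,d\rho(\bm\xi)\,d\mathbf x\ge 0.$$ *)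

theory Defs
  imports "HOL-Probability.Probability"
begin

section \<open>Lebesgue and Bochner spaces\<close>

definition Linf :: "'a measure \<Rightarrow> ('a \<Rightarrow> real) set" where
  "Linf M = {g \<in> borel_measurable M. \<exists>C. AE z in M. \<bar>g z\<bar> \<le> C}"

definition Linf_norm :: "'a measure \<Rightarrow> ('a \<Rightarrow> real) \<Rightarrow> ereal" where
  "Linf_norm M g = esssup M (\<lambda>z. ereal \<bar>g z\<bar>)"

text \<open>
  Strong measurability of a map from \<open>\<rho>\<close> into the Banach space of classes of essentially bounded
  functions on \<open>M\<close>: it is the \<open>\<rho>\<close>-a.e. limit, in the norm, of a sequence of simple functions. Maps
  into the quotient are given by representatives, so \<open>U \<xi>\<close> is an actual function on \<open>M\<close>.
\<close>
definition bochner_measurable :: "'b measure \<Rightarrow> 'a measure \<Rightarrow> ('b \<Rightarrow> 'a \<Rightarrow> real) \<Rightarrow> bool" where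
  "bochner_measurable \<rho> M U \<longleftrightarrow>
     (AE \<xi> in \<rho>. U \<xi> \<in> Linf M) \<and>
     (\<exists>s :: nat \<Rightarrow> 'b \<Rightarrow> 'a \<Rightarrow> real.
        (\<forall>k. simple_function \<rho> (s k) \<and> (\<forall>\<xi>\<in>space \<rho>. s k \<xi> \<in> Linf M)) \<and>
        (AE \<xi> in \<rho>. (\<lambda>k. Linf_norm M (\<lambda>z. s k \<xi> z - U \<xi> z)) \<longlonglongrightarrow> 0))"

definition bochner_Linf :: "'b measure \<Rightarrow> 'a measure \<Rightarrow> ('b \<Rightarrow> 'a \<Rightarrow> real) set" where
  "bochner_Linf \<rho> M =
     {U. bochner_measurable \<rho> M U \<and> (\<exists>C::real. AE \<xi> in \<rho>. Linf_norm M (U \<xi>) \<le> ereal C)}"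


section \<open>Test functions\<close>

abbreviation half_space :: "(real \<times> (real ^ 'n)) set" where
  "half_space \<equiv> {0..} \<times> UNIV"

text \<open>
  Derivatives are taken within the closed half space, so they are one-sided in time at \<open>t = 0\<close>.
\<close>
definition time_deriv :: "(real \<times> (real ^ 'n) \<Rightarrow> real) \<Rightarrow> real \<times> (real ^ 'n) \<Rightarrow> real" where
  "time_deriv \<psi> z = frechet_derivative \<psi> (at z within half_space) (1, 0)"

definition space_grad ::
  "(real \<times> (real ^ 'n) \<Rightarrow> real) \<Rightarrow> real \<times> (real ^ 'n) \<Rightarrow> real ^ 'n" where
  "space_grad \<psi> z = (\<chi> i. frechet_derivative \<psi> (at z within half_space) (0, axis i 1))"

definition C1 :: "(real \<times> (real ^ 'n) \<Rightarrow> real) set" where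
  "C1 = {\<psi>. \<psi> differentiable_on half_space \<and>
            continuous_on half_space (time_deriv \<psi>) \<and> continuous_on half_space (space_grad \<psi>)}"

text \<open>The support may meet \<open>t = 0\<close>; values outside the half space are irrelevant.\<close>
definition C1_on :: "(real \<times> (real ^ 'n)) set \<Rightarrow> (real \<times> (real ^ 'n) \<Rightarrow> real) set" where
  "C1_on K = {\<psi> \<in> C1. \<forall>z \<in> half_space - K. \<psi> z = 0}"

definition C1c :: "(real \<times> (real ^ 'n) \<Rightarrow> real) set" where
  "C1c = (\<Union>K\<in>{K. compact K \<and> K \<subseteq> half_space}. C1_on K)"

text \<open>
  Continuous maps from the compact set \<open>\<Xi>\<close> into \<open>C1c\<close> with its usual inductive limit topology.
  Since \<open>\<Xi>\<close> is compact, the range lies in one of the Banach spaces \<open>C1_on K\<close>, and continuity is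
  continuity for the \<open>C\<^sup>1\<close> norm of that space.
\<close>
definition C_C1c ::
  "'b::topological_space set \<Rightarrow> ('b \<Rightarrow> real \<times> (real ^ 'n) \<Rightarrow> real) set" where
  "C_C1c \<Xi> = {\<phi>. (\<exists>K. compact K \<and> K \<subseteq> half_space \<and> (\<forall>\<xi>\<in>\<Xi>. \<phi> \<xi> \<in> C1_on K)) \<and>
     (\<forall>\<xi>\<^sub>0\<in>\<Xi>.
        uniform_limit half_space \<phi> (\<phi> \<xi>\<^sub>0) (at \<xi>\<^sub>0 within \<Xi>) \<and>
        uniform_limit half_space (\<lambda>\<xi>. time_deriv (\<phi> \<xi>)) (time_deriv (\<phi> \<xi>\<^sub>0)) (at \<xi>\<^sub>0 within \<Xi>) \<and>
        uniform_limit half_space (\<lambda>\<xi>. space_grad (\<phi> \<xi>)) (space_grad (\<phi> \<xi>\<^sub>0)) (at \<xi>\<^sub>0 within \<Xi>))}"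


section \<open>Entropy solutions\<close>

type_synonym ('n, 'b) entropy_pair = "(real \<Rightarrow> real) \<times> (real \<Rightarrow> 'b \<Rightarrow> real ^ 'n)"

definition kruzhkov_family :: "(real \<Rightarrow> 'b \<Rightarrow> real ^ 'n) \<Rightarrow> ('n, 'b) entropy_pair set" where
  "kruzhkov_family f =
     range (\<lambda>v. (\<lambda>w. \<bar>w - v\<bar>, \<lambda>w \<xi>. sgn (w - v) *\<^sub>R (f w \<xi> - f v \<xi>)))"

definition parametric_entropy_solution ::
  "'b measure \<Rightarrow> ('n, 'b) entropy_pair set \<Rightarrow> (real ^ 'n \<Rightarrow> 'b \<Rightarrow> real)
     \<Rightarrow> (real \<Rightarrow> real ^ 'n \<Rightarrow> 'b \<Rightarrow> real) \<Rightarrow> bool" where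
  "parametric_entropy_solution \<rho> E u\<^sub>0 u \<longleftrightarrow>
     (AE \<xi> in \<rho>. (\<lambda>(t, x). u t x \<xi>) \<in> Linf (lebesgue_on half_space)) \<and>
     (\<forall>(\<eta>, q) \<in> E. \<forall>\<psi> \<in> C1c. (\<forall>z\<in>half_space. 0 \<le> \<psi> z) \<longrightarrow>
        (AE \<xi> in \<rho>.
           (LINT t|lebesgue_on {0..}. LINT x|lebesgue.
              time_deriv \<psi> (t, x) * \<eta> (u t x \<xi>) + space_grad \<psi> (t, x) \<bullet> q (u t x \<xi>) \<xi>)
           + (LINT x|lebesgue. \<psi> (0, x) * \<eta> (u\<^sub>0 x \<xi>)) \<ge> 0))"

text \<open>
  The set \<open>\<Xi>\<close> is \<open>space \<rho>\<close>. Completed measures are used throughout: sections of Lebesgue measurable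
  functions, and compositions with a flux that is continuous in the state only for \<open>\<rho>\<close>-almost all
  parameters, are measurable only up to null sets.
\<close>
definition weak_parametric_entropy_solution_rep ::
  "'b::topological_space measure \<Rightarrow> ('n, 'b) entropy_pair set \<Rightarrow> (real ^ 'n \<Rightarrow> 'b \<Rightarrow> real)
     \<Rightarrow> (real \<Rightarrow> real ^ 'n \<Rightarrow> 'b \<Rightarrow> real) \<Rightarrow> bool" where
  "weak_parametric_entropy_solution_rep \<rho> E u\<^sub>0 u \<longleftrightarrow>
     (\<lambda>((t, x), \<xi>). u t x \<xi>) \<in> Linf (completion (lebesgue_on half_space \<Otimes>\<^sub>M \<rho>)) \<and>
     (\<forall>(\<eta>, q) \<in> E. \<forall>\<phi> \<in> C_C1c (space \<rho>). (\<forall>\<xi>\<in>space \<rho>. \<forall>z\<in>half_space. 0 \<le> \<phi> \<xi> z) \<longrightarrow>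
        (LINT t|lebesgue_on {0..}. LINT x|lebesgue. LINT \<xi>|completion \<rho>.
           time_deriv (\<phi> \<xi>) (t, x) * \<eta> (u t x \<xi>) + space_grad (\<phi> \<xi>) (t, x) \<bullet> q (u t x \<xi>) \<xi>)
        + (LINT x|lebesgue. LINT \<xi>|completion \<rho>. \<phi> \<xi> (0, x) * \<eta> (u\<^sub>0 x \<xi>)) \<ge> 0)"

text \<open>
  A map from \<open>\<Xi>\<close> into a space of classes of functions determines a function of all variables only up
  to the following relation. It does not preserve joint measurability: there are sets that are not
  measurable in the product although all their sections at fixed \<open>\<xi>\<close> are null (Sierpinski), and
  their indicator functions represent the zero map. A weak-parametric solution, whose definition
  involves the joint variables, is therefore tested on jointly measurable versions of \<open>u\<close> and
  \<open>u\<^sub>0\<close>; the lemma below shows that this changes nothing if \<open>u\<close> and \<open>u\<^sub>0\<close> are themselves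
  jointly measurable.
\<close>
definition is_version :: "'b measure \<Rightarrow> 'a measure \<Rightarrow> ('b \<Rightarrow> 'a \<Rightarrow> real) \<Rightarrow> ('b \<Rightarrow> 'a \<Rightarrow> real) \<Rightarrow> bool"
  where "is_version \<rho> M U V \<longleftrightarrow> (AE \<xi> in \<rho>. AE z in M. V \<xi> z = U \<xi> z)"

definition weak_parametric_entropy_solution ::
  "'b::topological_space measure \<Rightarrow> ('n, 'b) entropy_pair set \<Rightarrow> (real ^ 'n \<Rightarrow> 'b \<Rightarrow> real)
     \<Rightarrow> (real \<Rightarrow> real ^ 'n \<Rightarrow> 'b \<Rightarrow> real) \<Rightarrow> bool" where
  "weak_parametric_entropy_solution \<rho> E u\<^sub>0 u \<longleftrightarrow>
     (\<exists>u' u\<^sub>0'.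
        is_version \<rho> (lebesgue_on half_space) (\<lambda>\<xi> (t, x). u t x \<xi>) (\<lambda>\<xi> (t, x). u' t x \<xi>) \<and>
        is_version \<rho> lebesgue (\<lambda>\<xi> x. u\<^sub>0 x \<xi>) (\<lambda>\<xi> x. u\<^sub>0' x \<xi>) \<and>
        (\<lambda>(x, \<xi>). u\<^sub>0' x \<xi>) \<in> borel_measurable (completion (lebesgue \<Otimes>\<^sub>M \<rho>)) \<and>
        weak_parametric_entropy_solution_rep \<rho> E u\<^sub>0' u')"

lemma (in complete_measure) measurable_AE_eq:
  fixes g h :: "'a \<Rightarrow> real"
  assumes eq: "AE z in M. g z = h z" and g: "g \<in> borel_measurable M"
  shows "h \<in> borel_measurable M"
proof (rule measurableI)
  fix A :: "real set" assume A: "A \<in> sets borel"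
  show "h -` A \<inter> space M \<in> sets M"
  proof (rule in_sets_AE)
    show "AE z in M. z \<in> g -` A \<inter> space M \<longleftrightarrow> z \<in> h -` A \<inter> space M"
      using eq by eventually_elim auto
    show "g -` A \<inter> space M \<in> sets M"
      using g A by (rule measurable_sets)
  qed auto
qed auto

lemma (in complete_measure) integral_AE_eq:
  fixes g h :: "'a \<Rightarrow> real"
  assumes eq: "AE z in M. g z = h z"
  shows "integral\<^sup>L M g = integral\<^sup>L M h"
proof (cases "g \<in> borel_measurable M")
  case True
  with measurable_AE_eq[OF eq] show ?thesis
    by (intro integral_cong_AE eq)
next
  case False
  have eq': "AE z in M. h z = g z"
    using eq by eventually_elim simp
  then have "h \<notin> borel_measurable M"
    using False measurable_AE_eq by blast
  with False show ?thesis
    by (metis borel_measurable_integrable not_integrable_integral_eq)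
qed

lemma complete_measure_lebesgue_on:
  assumes "S \<in> sets lebesgue"
  shows "complete_measure (lebesgue_on S)"
proof
  fix A B assume "B \<subseteq> A" and A: "A \<in> null_sets (lebesgue_on S)"
  then have "A \<in> null_sets lebesgue" "A \<subseteq> S"
    using null_sets_restrict_space[OF assms] by auto
  then have "B \<in> null_sets lebesgue" "B \<subseteq> S"
    using \<open>B \<subseteq> A\<close> completion.complete2 by auto
  then show "B \<in> sets (lebesgue_on S)"
    using null_sets_restrict_space[OF assms] by blast
qed

lemma (in pair_sigma_finite) AE_pair_swap:
  assumes "AE w in M1 \<Otimes>\<^sub>M M2. Q w"
  shows "AE y in M2. AE x in M1. Q (x, y)"
proof -
  obtain N where N: "N \<in> null_sets (M1 \<Otimes>\<^sub>M M2)" "{w \<in> space (M1 \<Otimes>\<^sub>M M2). \<not> Q w} \<subseteq> N"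
    using assms unfolding eventually_ae_filter by auto
  have [measurable]: "N \<in> sets (M1 \<Otimes>\<^sub>M M2)"
    using N(1) by auto
  have "AE x in M1. AE y in M2. (x, y) \<notin> N"
    using AE_pair[OF AE_not_in[OF N(1)]] .
  moreover have "{w \<in> space (M1 \<Otimes>\<^sub>M M2). (fst w, snd w) \<notin> N} \<in> sets (M1 \<Otimes>\<^sub>M M2)"
    by simp
  ultimately have *: "AE y in M2. AE x in M1. (x, y) \<notin> N"
    by (subst (asm) AE_commute)
  have "Q (x, y)" if "y \<in> space M2" "x \<in> space M1" "(x, y) \<notin> N" for x y
    using that N(2) by (auto simp: space_pair_measure)
  note Q = this
  show ?thesis
    using * AE_space
  proof eventually_elim
    case (elim y)
    show ?case
      using elim(1) AE_space by eventually_elim (use elim Q in blast)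
  qed
qed

lemma (in pair_sigma_finite) sections_AE_eq:
  fixes g h :: "'a \<times> 'b \<Rightarrow> real"
  assumes g: "g \<in> borel_measurable (completion (M1 \<Otimes>\<^sub>M M2))"
    and h: "h \<in> borel_measurable (completion (M1 \<Otimes>\<^sub>M M2))"
    and eq: "AE y in M2. AE x in M1. g (x, y) = h (x, y)"
  shows "AE w in M1 \<Otimes>\<^sub>M M2. g w = h w"
    and "AE x in M1. AE y in M2. g (x, y) = h (x, y)"
proof -
  have "(\<lambda>w. g w - h w) \<in> borel_measurable (completion (M1 \<Otimes>\<^sub>M M2))"
    using g h by simp
  then obtain d where d[measurable]: "d \<in> borel_measurable (M1 \<Otimes>\<^sub>M M2)"
    and gd: "AE w in M1 \<Otimes>\<^sub>M M2. g w - h w = d w"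
    using completion_ex_borel_measurable_real by blast
  have "AE y in M2. AE x in M1. d (x, y) = 0"
    using AE_pair_swap[OF gd] eq
  proof eventually_elim
    case (elim y)
    then show ?case by eventually_elim simp
  qed
  then have "AE x in M1. AE y in M2. d (x, y) = 0"
    by (subst AE_commute) auto
  then have "AE w in M1 \<Otimes>\<^sub>M M2. d w = 0"
    by (intro AE_pair_measure) auto
  with gd show *: "AE w in M1 \<Otimes>\<^sub>M M2. g w = h w"
    by eventually_elim simp
  show "AE x in M1. AE y in M2. g (x, y) = h (x, y)"
    using AE_pair[OF *] .
qed

lemma sigma_finite_completion:
  assumes "sigma_finite_measure M"
  shows "sigma_finite_measure (completion M)"
proof -
  obtain A where A: "countable A" "A \<subseteq> sets M" "\<Union>A = space M" "\<forall>a\<in>A. emeasure M a \<noteq> \<infinity>"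
    using sigma_finite_measure.sigma_finite_countable[OF assms] by blast
  then have "\<forall>a\<in>A. emeasure (completion M) a \<noteq> \<infinity>"
    by (metis emeasure_completion main_part sets_completionI_sets subsetD)
  with A show ?thesis
    by (intro sigma_finite_measure.intro exI[of _ A]) auto
qed

lemma half_space_lebesgue: "half_space \<in> sets (lebesgue :: (real \<times> (real ^ 'n)) measure)"
  by (intro borel_closed[THEN sets_completionI_sets[where M = lborel, simplified]] closed_Times) auto

lemma AE_half_space_split:
  fixes P :: "real \<times> (real ^ 'n) \<Rightarrow> bool"
  assumes "AE z in lebesgue_on half_space. P z"
  shows "AE t in lebesgue_on {0..}. AE x in lebesgue. P (t, x)"
proof -
  interpret lborel_pair: pair_sigma_finite "lborel :: real measure" "lborel :: (real ^ 'n) measure" ..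
  have "AE z in lebesgue. z \<in> half_space \<longrightarrow> P z"
    using assms half_space_lebesgue by (subst (asm) AE_restrict_space_iff) auto
  then have "AE z in lborel \<Otimes>\<^sub>M lborel. z \<in> half_space \<longrightarrow> P z"
    unfolding lborel_prod AE_completion_iff .
  from lborel_pair.AE_pair[OF this] have "AE t in lborel. t \<in> {0..} \<longrightarrow> (AE x in lborel. P (t, x))"
    by eventually_elim auto
  then show ?thesis
    by (subst AE_restrict_space_iff) (auto simp: AE_completion_iff)
qed

lemma weak_parametric_entropy_solution_iff_rep:
  fixes u :: "real \<Rightarrow> real ^ 'n \<Rightarrow> 'b::topological_space \<Rightarrow> real"
  assumes "prob_space \<rho>"
    and u: "(\<lambda>((t, x), \<xi>). u t x \<xi>) \<in>
              borel_measurable (completion (lebesgue_on half_space \<Otimes>\<^sub>M \<rho>))"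
    and u0: "(\<lambda>(x, \<xi>). u\<^sub>0 x \<xi>) \<in> borel_measurable (completion (lebesgue \<Otimes>\<^sub>M \<rho>))"
  shows "weak_parametric_entropy_solution \<rho> E u\<^sub>0 u \<longleftrightarrow>
         weak_parametric_entropy_solution_rep \<rho> E u\<^sub>0 u"
proof
  assume "weak_parametric_entropy_solution_rep \<rho> E u\<^sub>0 u"
  then show "weak_parametric_entropy_solution \<rho> E u\<^sub>0 u"
    unfolding weak_parametric_entropy_solution_def is_version_def
    using u0 by (intro exI[of _ u] exI[of _ u\<^sub>0]) auto
next
  assume "weak_parametric_entropy_solution \<rho> E u\<^sub>0 u"
  then obtain u' u0' where
    vu: "AE \<xi> in \<rho>. AE z in lebesgue_on half_space. (\<lambda>(t, x). u' t x \<xi>) z = (\<lambda>(t, x). u t x \<xi>) z"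
    and vu0: "AE \<xi> in \<rho>. AE x in lebesgue. u0' x \<xi> = u\<^sub>0 x \<xi>"
    and u0': "(\<lambda>(x, \<xi>). u0' x \<xi>) \<in> borel_measurable (completion (lebesgue \<Otimes>\<^sub>M \<rho>))"
    and rep: "weak_parametric_entropy_solution_rep \<rho> E u0' u'"
    unfolding weak_parametric_entropy_solution_def is_version_def by auto
  interpret \<rho>: prob_space \<rho> by fact
  interpret L: sigma_finite_measure "lebesgue :: (real ^ 'n) measure"
    by (rule sigma_finite_completion) (rule lborel.sigma_finite_measure_axioms)
  interpret LH: sigma_finite_measure "lebesgue_on half_space :: (real \<times> (real ^ 'n)) measure"
    using half_space_lebesgue
    by (intro sigma_finite_measure_restrict_space sigma_finite_completion lborel.sigma_finite_measure_axioms)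
  interpret PX: pair_sigma_finite "lebesgue :: (real ^ 'n) measure" \<rho> ..
  interpret PH: pair_sigma_finite "lebesgue_on half_space :: (real \<times> (real ^ 'n)) measure" \<rho> ..
  interpret T: complete_measure "lebesgue_on {0 :: real ..}"
    by (rule complete_measure_lebesgue_on) simp
  have u': "(\<lambda>((t, x), \<xi>). u' t x \<xi>) \<in> Linf (completion (lebesgue_on half_space \<Otimes>\<^sub>M \<rho>))"
    using rep unfolding weak_parametric_entropy_solution_rep_def by auto
  have vu': "AE \<xi> in \<rho>. AE z in lebesgue_on half_space.
      (\<lambda>((t, x), \<xi>). u' t x \<xi>) (z, \<xi>) = (\<lambda>((t, x), \<xi>). u t x \<xi>) (z, \<xi>)"
    using vu by (simp add: case_prod_beta)
  note eqs = PH.sections_AE_eq[OF _ u vu']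
  have eq1: "AE w in lebesgue_on half_space \<Otimes>\<^sub>M \<rho>. (\<lambda>((t, x), \<xi>). u' t x \<xi>) w = (\<lambda>((t, x), \<xi>). u t x \<xi>) w"
    using u' by (intro eqs) (simp add: Linf_def)
  have "AE z in lebesgue_on half_space. AE \<xi> in \<rho>.
      (\<lambda>((t, x), \<xi>). u' t x \<xi>) (z, \<xi>) = (\<lambda>((t, x), \<xi>). u t x \<xi>) (z, \<xi>)"
    using u' by (intro eqs) (simp add: Linf_def)
  from AE_half_space_split[OF this]
  have eq2: "AE t in lebesgue_on {0..}. AE x in lebesgue. AE \<xi> in completion \<rho>. u' t x \<xi> = u t x \<xi>"
    by (simp add: AE_completion_iff)
  have eq3: "AE x in lebesgue. AE \<xi> in completion \<rho>. u0' x \<xi> = u\<^sub>0 x \<xi>"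
    using PX.sections_AE_eq(2)[OF u0' u0] vu0 by (simp add: AE_completion_iff)
  have "\<exists>C. AE w in completion (lebesgue_on half_space \<Otimes>\<^sub>M \<rho>). \<bar>(\<lambda>((t, x), \<xi>). u t x \<xi>) w\<bar> \<le> C"
  proof -
    obtain C where "AE w in lebesgue_on half_space \<Otimes>\<^sub>M \<rho>. \<bar>(\<lambda>((t, x), \<xi>). u' t x \<xi>) w\<bar> \<le> C"
      using u' unfolding Linf_def by (auto simp: AE_completion_iff)
    with eq1 have "AE w in lebesgue_on half_space \<Otimes>\<^sub>M \<rho>. \<bar>(\<lambda>((t, x), \<xi>). u t x \<xi>) w\<bar> \<le> C"
      by eventually_elim simp
    then show ?thesis by (auto simp: AE_completion_iff)
  qed
  moreover
  have i1: "(LINT t|lebesgue_on {0..}. LINT x|lebesgue. LINT \<xi>|completion \<rho>. F t x \<xi> (u' t x \<xi>))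
      = (LINT t|lebesgue_on {0..}. LINT x|lebesgue. LINT \<xi>|completion \<rho>. F t x \<xi> (u t x \<xi>))"
    for F :: "real \<Rightarrow> real ^ 'n \<Rightarrow> 'b \<Rightarrow> real \<Rightarrow> real"
  proof (rule T.integral_AE_eq, use eq2 in eventually_elim)
    case (elim t)
    show ?case
    proof (rule completion.integral_AE_eq, use elim in eventually_elim)
      case (elim x)
      show ?case
        by (rule completion.integral_AE_eq, use elim in eventually_elim) simp
    qed
  qed
  have i2: "(LINT x|lebesgue. LINT \<xi>|completion \<rho>. F x \<xi> (u0' x \<xi>))
      = (LINT x|lebesgue. LINT \<xi>|completion \<rho>. F x \<xi> (u\<^sub>0 x \<xi>))"
    for F :: "real ^ 'n \<Rightarrow> 'b \<Rightarrow> real \<Rightarrow> real"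
  proof (rule completion.integral_AE_eq, use eq3 in eventually_elim)
    case (elim x)
    show ?case
      by (rule completion.integral_AE_eq, use elim in eventually_elim) simp
  qed
  ultimately show "weak_parametric_entropy_solution_rep \<rho> E u\<^sub>0 u"
    using rep u i1[of "\<lambda>t x \<xi> w. time_deriv (\<phi> \<xi>) (t, x) * \<eta> w + space_grad (\<phi> \<xi>) (t, x) \<bullet> q w \<xi>" for \<phi> \<eta> q]
      i2[of "\<lambda>x \<xi> w. \<phi> \<xi> (0 :: real, x) * \<eta> w" for \<phi> \<eta>]
    unfolding weak_parametric_entropy_solution_rep_def Linf_def by simp
qed

end

theory Submission
  imports Defs
begin

text \<open>
  Both notions ask for the sign of the same functional. For a test function \<open>\<psi>\<close> and a constant \<open>v\<close>
  let \<open>J v \<psi> \<xi>\<close> be the left-hand side of the entropy inequality at the parameter \<open>\<xi>\<close>. By Fubini, the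
  weak-parametric inequality for \<open>\<phi>\<close> says that \<open>J v (\<phi> \<xi>) \<xi>\<close> has nonnegative integral over \<open>\<xi>\<close>,
  whereas the parametric one says that \<open>J v \<psi> \<xi> \<ge> 0\<close> for almost all \<open>\<xi>\<close>.

  If the latter holds, the exceptional null set depends on \<open>\<psi>\<close>. Let \<open>\<psi>\<close> run through the values of \<open>\<phi>\<close>
  at a countable dense set of parameters. As \<open>J v \<psi> \<xi>\<close> is continuous in \<open>\<psi>\<close>, one null set serves
  all values of \<open>\<phi>\<close>, hence \<open>J v (\<phi> \<xi>) \<xi> \<ge> 0\<close> almost everywhere (\<open>pointwise_imp_integrated\<close>).
  Conversely, the test functions \<open>\<theta> \<xi> * \<psi> z\<close> with continuous \<open>\<theta> \<ge> 0\<close> localise the integrated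
  inequality, and inner regularity of \<open>\<rho>\<close> gives the sign almost everywhere
  (\<open>AE_nonneg_of_continuous_tests\<close>, \<open>integrated_imp_pointwise\<close>).

  These arguments need jointly measurable and uniformly bounded data. Strong measurability provides
  jointly measurable versions of \<open>u\<close> and \<open>u\<^sub>0\<close> (\<open>bochner_measurable_version\<close>), and the flux can be
  replaced on a null set of parameters by a jointly measurable one (\<open>flux_version\<close>). A
  weak-parametric solution is bounded by definition, but a parametric solution is a priori bounded
  only for each parameter separately. A bound uniform in the parameter comes from the maximum principle
  \<open>\<bar>u\<bar> \<le> M\<close>, where \<open>M\<close> bounds the initial data (\<open>parametric_entropy_solution_bound\<close>): Kruzhkov
  entropies yield an inequality for the positive part of \<open>u - M\<close>, and testing it with functions that
  decrease in time faster than the speed of propagation shows that this positive part vanishes.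
\<close>

section \<open>Derivatives in the closed half space\<close>

lemma half_space_borel [measurable]: "half_space \<in> sets (borel :: (real \<times> (real ^ 'n)) measure)"
  by (intro borel_closed closed_Times) auto

lemma frechet_derivative_half_space:
  fixes \<psi> :: "real \<times> (real ^ 'n) \<Rightarrow> real"
  assumes D: "(\<psi> has_derivative D) (at z within half_space)" and z: "z \<in> half_space"
  shows "frechet_derivative \<psi> (at z within half_space) = D"
proof (rule frechet_derivative_unique_within[OF _ D])
  show "(\<psi> has_derivative frechet_derivative \<psi> (at z within half_space)) (at z within half_space)"
    using D frechet_derivative_works differentiable_def by blast
  fix i :: "real \<times> (real ^ 'n)" and e :: real
  assume i: "i \<in> Basis" and e: "0 < e"
  \<comment> \<open>A positive step in any coordinate direction stays in the half space, also from its boundary.\<close>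
  have "0 \<le> fst i" using i by (auto simp: Basis_prod_def)
  then show "\<exists>d. 0 < \<bar>d\<bar> \<and> \<bar>d\<bar> < e \<and> z + d *\<^sub>R i \<in> half_space"
    using e z by (intro exI[of _ "e / 2"]) (auto simp: mem_Times_iff)
qed

lemma time_deriv_eq:
  assumes "(\<psi> has_derivative D) (at z within half_space)" "z \<in> half_space"
  shows "time_deriv \<psi> z = D (1, 0)"
  unfolding time_deriv_def using frechet_derivative_half_space[OF assms] by simp

lemma space_grad_eq:
  assumes "(\<psi> has_derivative D) (at z within half_space)" "z \<in> half_space"
  shows "space_grad \<psi> z = (\<chi> i. D (0, axis i 1))"
  unfolding space_grad_def using frechet_derivative_half_space[OF assms] by simp

lemma C1_has_derivative:
  assumes "\<psi> \<in> C1" "z \<in> half_space"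
  shows "(\<psi> has_derivative frechet_derivative \<psi> (at z within half_space)) (at z within half_space)"
  using assms unfolding C1_def differentiable_on_def by (blast intro: frechet_derivative_works[THEN iffD1])

lemma C1_on_continuous:
  assumes "\<psi> \<in> C1_on K"
  shows "continuous_on half_space \<psi>" "continuous_on half_space (time_deriv \<psi>)"
    "continuous_on half_space (space_grad \<psi>)"
  using assms by (auto simp: C1_on_def C1_def intro: differentiable_imp_continuous_on)

lemma C1_on_derivs_zero:
  assumes \<psi>: "\<psi> \<in> C1_on K" and K: "closed K" and z: "z \<in> half_space - K"
  shows "time_deriv \<psi> z = 0" "space_grad \<psi> z = 0"
proof -
  have "((\<lambda>_. 0::real) has_derivative (\<lambda>_. 0)) (at z within half_space)" by simp
  then have D: "(\<psi> has_derivative (\<lambda>_. 0)) (at z within half_space)"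
  proof (rule has_derivative_transform_eventually)
    have "eventually (\<lambda>y. y \<in> - K) (at z within half_space)"
      using K z by (auto intro!: eventually_at_in_open' simp: eventually_at_filter eventually_nhds)
    then show "\<forall>\<^sub>F y in at z within half_space. 0 = \<psi> y"
      unfolding eventually_at_filter
      by eventually_elim (use \<psi> in \<open>auto simp: C1_on_def\<close>)
  qed (use \<psi> z in \<open>auto simp: C1_on_def\<close>)
  show "time_deriv \<psi> z = 0" "space_grad \<psi> z = 0"
    using time_deriv_eq[OF D] space_grad_eq[OF D] z by (auto simp: vec_eq_iff)
qed

lemma C1_on_scale:
  fixes \<psi> :: "real \<times> (real ^ 'n) \<Rightarrow> real"
  assumes \<psi>: "\<psi> \<in> C1_on K"
  shows "(\<lambda>z. c * \<psi> z) \<in> C1_on K"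
    and "z \<in> half_space \<Longrightarrow> time_deriv (\<lambda>z. c * \<psi> z) z = c * time_deriv \<psi> z"
    and "z \<in> half_space \<Longrightarrow> space_grad (\<lambda>z. c * \<psi> z) z = c *\<^sub>R space_grad \<psi> z"
proof -
  have D: "((\<lambda>z. c * \<psi> z) has_derivative
      (\<lambda>h. c * frechet_derivative \<psi> (at z within half_space) h)) (at z within half_space)"
    if "z \<in> half_space" for z
    using \<psi> C1_has_derivative[OF _ that] by (intro has_derivative_mult_right) (auto simp: C1_on_def)
  show t: "time_deriv (\<lambda>z. c * \<psi> z) z = c * time_deriv \<psi> z" if "z \<in> half_space" for z
    using time_deriv_eq[OF D[OF that] that] by (simp add: time_deriv_def)
  show s: "space_grad (\<lambda>z. c * \<psi> z) z = c *\<^sub>R space_grad \<psi> z" if "z \<in> half_space" for z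
    using space_grad_eq[OF D[OF that] that] by (simp add: space_grad_def vec_eq_iff)
  have "(\<lambda>z. c * \<psi> z) differentiable_on half_space"
    using D by (auto simp: differentiable_on_def differentiable_def)
  moreover have "continuous_on half_space (time_deriv (\<lambda>z. c * \<psi> z))"
    using C1_on_continuous(2)[OF \<psi>]
    by (subst continuous_on_cong[OF refl t]) (auto intro!: continuous_intros)
  moreover have "continuous_on half_space (space_grad (\<lambda>z. c * \<psi> z))"
    using C1_on_continuous(3)[OF \<psi>]
    by (subst continuous_on_cong[OF refl s]) (auto intro!: continuous_intros)
  ultimately show "(\<lambda>z. c * \<psi> z) \<in> C1_on K"
    using \<psi> by (auto simp: C1_on_def C1_def)
qed


section \<open>Parameter-dependent test functions\<close>

lemma const_in_C_C1c:
  assumes "\<psi> \<in> C1_on K" "compact K" "K \<subseteq> half_space"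
  shows "(\<lambda>_. \<psi>) \<in> C_C1c \<Xi>"
  using assms by (auto simp: C_C1c_def intro!: exI[of _ K] uniform_limit_const)

text \<open>Products \<open>\<theta> \<otimes> \<psi>\<close> of a continuous function of the parameter and a test function.\<close>
lemma scale_in_C_C1c:
  fixes \<theta> :: "'b::topological_space \<Rightarrow> real" and \<psi> :: "real \<times> (real ^ 'n) \<Rightarrow> real"
  assumes \<psi>: "\<psi> \<in> C1_on K" and K: "compact K" "K \<subseteq> half_space" and \<theta>: "continuous_on \<Xi> \<theta>"
  shows "(\<lambda>\<xi> z. \<theta> \<xi> * \<psi> z) \<in> C_C1c \<Xi>"
proof -
  have bounded_half_space: "bounded (h ` half_space)"
    if "continuous_on half_space h" "\<forall>z\<in>half_space - K. h z = 0"
    for h :: "real \<times> (real ^ 'n) \<Rightarrow> 'c::real_normed_vector"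
  proof -
    have "bounded (h ` K)"
      using that(1) K by (intro compact_imp_bounded compact_continuous_image) (auto intro: continuous_on_subset)
    then have "bounded (insert 0 (h ` K))" by simp
    then show ?thesis
      by (rule bounded_subset) (use that(2) in auto)
  qed
  have lim: "uniform_limit half_space (\<lambda>\<xi> z. \<theta> \<xi> *\<^sub>R h z) (\<lambda>z. \<theta> \<xi>\<^sub>0 *\<^sub>R h z) (at \<xi>\<^sub>0 within \<Xi>)"
    if h: "bounded (h ` half_space)" and \<xi>\<^sub>0: "\<xi>\<^sub>0 \<in> \<Xi>" for \<xi>\<^sub>0
    and h :: "real \<times> (real ^ 'n) \<Rightarrow> 'c::real_normed_vector"
  proof (rule uniform_limitI)
    fix e :: real assume "0 < e"
    obtain B where B: "0 < B" "\<And>z. z \<in> half_space \<Longrightarrow> norm (h z) \<le> B"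
      using h unfolding bounded_pos by auto
    have "(\<theta> \<longlongrightarrow> \<theta> \<xi>\<^sub>0) (at \<xi>\<^sub>0 within \<Xi>)"
      using \<theta> \<xi>\<^sub>0 by (simp add: continuous_on_def)
    then have "\<forall>\<^sub>F \<xi> in at \<xi>\<^sub>0 within \<Xi>. dist (\<theta> \<xi>) (\<theta> \<xi>\<^sub>0) < e / B"
      using \<open>0 < e\<close> B(1) by (intro tendstoD) auto
    then show "\<forall>\<^sub>F \<xi> in at \<xi>\<^sub>0 within \<Xi>. \<forall>z\<in>half_space. dist (\<theta> \<xi> *\<^sub>R h z) (\<theta> \<xi>\<^sub>0 *\<^sub>R h z) < e"
    proof eventually_elim
      case (elim \<xi>)
      show ?case
      proof
        fix z :: "real \<times> (real ^ 'n)" assume z: "z \<in> half_space"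
        have "dist (\<theta> \<xi> *\<^sub>R h z) (\<theta> \<xi>\<^sub>0 *\<^sub>R h z) = \<bar>\<theta> \<xi> - \<theta> \<xi>\<^sub>0\<bar> * norm (h z)"
          by (simp add: dist_norm scaleR_diff_left[symmetric])
        also have "\<dots> \<le> \<bar>\<theta> \<xi> - \<theta> \<xi>\<^sub>0\<bar> * B"
          using B(2)[OF z] by (intro mult_left_mono) auto
        also have "\<dots> < e"
          using elim B(1) by (simp add: dist_real_def pos_less_divide_eq)
        finally show "dist (\<theta> \<xi> *\<^sub>R h z) (\<theta> \<xi>\<^sub>0 *\<^sub>R h z) < e" .
      qed
    qed
  qed
  have K': "closed K" using K compact_imp_closed by auto
  have "\<forall>z\<in>half_space - K. \<psi> z = 0" using \<psi> by (auto simp: C1_on_def)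
  note bounds = bounded_half_space[OF C1_on_continuous(1)[OF \<psi>] this]
    bounded_half_space[OF C1_on_continuous(2)[OF \<psi>]]
    bounded_half_space[OF C1_on_continuous(3)[OF \<psi>]]
  have "uniform_limit half_space (\<lambda>\<xi> z. \<theta> \<xi> * \<psi> z) (\<lambda>z. \<theta> \<xi>\<^sub>0 * \<psi> z) (at \<xi>\<^sub>0 within \<Xi>) \<and>
      uniform_limit half_space (\<lambda>\<xi>. time_deriv (\<lambda>z. \<theta> \<xi> * \<psi> z))
        (time_deriv (\<lambda>z. \<theta> \<xi>\<^sub>0 * \<psi> z)) (at \<xi>\<^sub>0 within \<Xi>) \<and>
      uniform_limit half_space (\<lambda>\<xi>. space_grad (\<lambda>z. \<theta> \<xi> * \<psi> z))
        (space_grad (\<lambda>z. \<theta> \<xi>\<^sub>0 * \<psi> z)) (at \<xi>\<^sub>0 within \<Xi>)" if "\<xi>\<^sub>0 \<in> \<Xi>" for \<xi>\<^sub>0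
    using lim[OF bounds(1) that] lim[OF bounds(2) that] lim[OF bounds(3) that]
      C1_on_derivs_zero[OF \<psi> K'] C1_on_scale(2,3)[OF \<psi>]
    by (simp cong: uniform_limit_cong')
  then show ?thesis
    using C1_on_scale(1)[OF \<psi>] K by (auto simp: C_C1c_def)
qed

text \<open>
  Joint continuity in all variables turns the uniform limits of the definition of \<open>C_C1c\<close> into
  measurability and uniform bounds.
\<close>
lemma continuous_on_Times_uniform_limit:
  fixes \<Phi> :: "'b::metric_space \<Rightarrow> 'a::metric_space \<Rightarrow> 'c::metric_space"
  assumes lim: "\<And>\<xi>\<^sub>0. \<xi>\<^sub>0 \<in> \<Xi> \<Longrightarrow> uniform_limit H \<Phi> (\<Phi> \<xi>\<^sub>0) (at \<xi>\<^sub>0 within \<Xi>)"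
    and cont: "\<And>\<xi>. \<xi> \<in> \<Xi> \<Longrightarrow> continuous_on H (\<Phi> \<xi>)"
  shows "continuous_on (H \<times> \<Xi>) (\<lambda>(z, \<xi>). \<Phi> \<xi> z)"
  unfolding continuous_on_iff
proof (intro ballI allI impI)
  fix p and e :: real assume p: "p \<in> H \<times> \<Xi>" and e: "0 < e"
  obtain z \<xi> where [simp]: "p = (z, \<xi>)" and z: "z \<in> H" and \<xi>: "\<xi> \<in> \<Xi>" using p by auto
  have "\<forall>\<^sub>F \<xi>' in at \<xi> within \<Xi>. \<forall>y\<in>H. dist (\<Phi> \<xi>' y) (\<Phi> \<xi> y) < e / 2"
    using lim[OF \<xi>] e by (intro uniform_limitD) auto
  then obtain d1 where d1: "0 < d1"
    "\<And>\<xi>' y. \<xi>' \<in> \<Xi> \<Longrightarrow> \<xi>' \<noteq> \<xi> \<Longrightarrow> dist \<xi>' \<xi> < d1 \<Longrightarrow> y \<in> H \<Longrightarrow> dist (\<Phi> \<xi>' y) (\<Phi> \<xi> y) < e / 2"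
    unfolding eventually_at by auto
  obtain d2 where d2: "0 < d2" "\<And>y. y \<in> H \<Longrightarrow> dist y z < d2 \<Longrightarrow> dist (\<Phi> \<xi> y) (\<Phi> \<xi> z) < e / 2"
    using cont[OF \<xi>] z e unfolding continuous_on_iff by (metis half_gt_zero)
  have "dist (\<Phi> \<xi>' y) (\<Phi> \<xi> z) < e"
    if "y \<in> H" "\<xi>' \<in> \<Xi>" "dist (y, \<xi>') (z, \<xi>) < min d1 d2" for y \<xi>'
  proof -
    have "dist y z < d2" "dist \<xi>' \<xi> < d1"
      using that(3) dist_fst_le[of "(y, \<xi>')" "(z, \<xi>)"] dist_snd_le[of "(y, \<xi>')" "(z, \<xi>)"] by auto
    then have "dist (\<Phi> \<xi>' y) (\<Phi> \<xi> y) < e / 2" "dist (\<Phi> \<xi> y) (\<Phi> \<xi> z) < e / 2"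
      using d1 d2 that e by (cases "\<xi>' = \<xi>"; auto)+
    then show ?thesis using dist_triangle[of "\<Phi> \<xi>' y" "\<Phi> \<xi> z" "\<Phi> \<xi> y"] by simp
  qed
  then show "\<exists>d>0. \<forall>x'\<in>H \<times> \<Xi>. dist x' p < d \<longrightarrow>
      dist (case x' of (z, \<xi>) \<Rightarrow> \<Phi> \<xi> z) (case p of (z, \<xi>) \<Rightarrow> \<Phi> \<xi> z) < e"
    using d1(1) d2(1) by (intro exI[of _ "min d1 d2"]) auto
qed

lemma bounded_compact_support_Times:
  fixes \<Phi> :: "'b::metric_space \<Rightarrow> 'a::metric_space \<Rightarrow> 'c::real_normed_vector"
  assumes "continuous_on (H \<times> \<Xi>) (\<lambda>(z, \<xi>). \<Phi> \<xi> z)" "compact K" "K \<subseteq> H" "compact \<Xi>"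
    and "\<And>\<xi> z. \<xi> \<in> \<Xi> \<Longrightarrow> z \<in> H - K \<Longrightarrow> \<Phi> \<xi> z = 0"
  obtains B where "0 \<le> B" "\<And>\<xi> z. \<xi> \<in> \<Xi> \<Longrightarrow> z \<in> H \<Longrightarrow> norm (\<Phi> \<xi> z) \<le> B"
proof -
  have "bounded ((\<lambda>(z, \<xi>). \<Phi> \<xi> z) ` (K \<times> \<Xi>))"
    using assms by (intro compact_imp_bounded compact_continuous_image compact_Times)
      (auto intro: continuous_on_subset)
  then obtain B where B: "0 < B" "\<And>z \<xi>. z \<in> K \<Longrightarrow> \<xi> \<in> \<Xi> \<Longrightarrow> norm (\<Phi> \<xi> z) \<le> B"
    unfolding bounded_pos by auto
  then have "norm (\<Phi> \<xi> z) \<le> B" if "\<xi> \<in> \<Xi>" "z \<in> H" for \<xi> z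
    using assms(5)[OF that(1), of z] that by (cases "z \<in> K") auto
  with B(1) show thesis by (intro that[of B]) auto
qed

section \<open>Iterated integrals and measurable sections\<close>

lemma integrable_compact_support:
  fixes F :: "'a::euclidean_space \<Rightarrow> 'c::{banach, second_countable_topology}"
  assumes "F \<in> borel_measurable lborel" "compact K" "\<And>z. norm (F z) \<le> B" "\<And>z. z \<notin> K \<Longrightarrow> F z = 0"
  shows "integrable lborel F"
  using assms borel_compact[of K] emeasure_compact_finite[of K]
  by (intro integrableI_bounded_set[of K _ _ B]) auto

lemma integrable_compact_support_pair:
  fixes F :: "'a::euclidean_space \<times> 'b \<Rightarrow> 'c::{banach, second_countable_topology}"
  assumes \<rho>: "prob_space \<rho>" and F: "F \<in> borel_measurable (lborel \<Otimes>\<^sub>M \<rho>)" and K: "compact K"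
    and B: "\<And>z \<xi>. \<xi> \<in> space \<rho> \<Longrightarrow> norm (F (z, \<xi>)) \<le> B"
    and 0: "\<And>z \<xi>. \<xi> \<in> space \<rho> \<Longrightarrow> z \<notin> K \<Longrightarrow> F (z, \<xi>) = 0"
  shows "integrable (lborel \<Otimes>\<^sub>M \<rho>) F"
proof -
  interpret prob_space \<rho> by fact
  have Kb: "K \<in> sets lborel" using borel_compact[OF K] by simp
  have "emeasure (lborel \<Otimes>\<^sub>M \<rho>) (K \<times> space \<rho>) = emeasure lborel K * emeasure \<rho> (space \<rho>)"
    using Kb by (intro emeasure_pair_measure_Times) auto
  also have "\<dots> < \<infinity>"
    using emeasure_compact_finite[OF K] by (simp add: emeasure_space_1)
  finally show ?thesis
    using F B 0 Kb by (intro integrableI_bounded_set[of "K \<times> space \<rho>" _ _ B] AE_I2)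
      (auto simp: space_pair_measure)
qed

lemma integral_half_space_iterated:
  fixes G :: "real \<times> (real ^ 'n) \<Rightarrow> real"
  assumes G: "integrable lborel G" and neg: "\<And>t x. t < 0 \<Longrightarrow> G (t, x) = 0"
  shows "(LINT t|lebesgue_on {0..}. LINT x|lebesgue. G (t, x)) = (LINT z|lborel. G z)"
proof -
  have [measurable]: "G \<in> borel_measurable (lborel \<Otimes>\<^sub>M lborel)"
    using G by (simp add: lborel_prod borel_measurable_integrable)
  have inner: "(LINT x|lebesgue. G (t, x)) = (LINT x|lborel. G (t, x))" for t
    by (rule integral_completion) measurable
  have "(LINT t|lebesgue_on {0..}. LINT x|lebesgue. G (t, x)) =
      (LINT t|lebesgue. indicator {0..} t *\<^sub>R (LINT x|lborel. G (t, x)))"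
    unfolding inner by (rule integral_restrict_space) auto
  also have "\<dots> = (LINT t|lebesgue. LINT x|lborel. G (t, x))"
    by (intro Bochner_Integration.integral_cong) (auto simp: indicator_def neg)
  also have "\<dots> = (LINT t|lborel. LINT x|lborel. G (t, x))"
    by (rule integral_completion) measurable
  also have "\<dots> = (LINT z|lborel. G z)"
    using lborel_pair.integral_fst'[of G] G by (simp add: lborel_prod)
  finally show ?thesis .
qed

lemma floor_approx_tendsto:
  "(\<lambda>n. of_int \<lfloor>real (Suc n) * y\<rfloor> / real (Suc n) :: real) \<longlonglongrightarrow> y"
proof (rule tendsto_sandwich[of "\<lambda>n. y - inverse (real (Suc n))" _ _ "\<lambda>_. y"])
  let ?a = "\<lambda>(n::nat) (y::real). of_int \<lfloor>real (Suc n) * y\<rfloor> / real (Suc n) :: real"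
  have bds: "y - inverse (real (Suc n)) \<le> ?a n y \<and> ?a n y \<le> y" for n
  proof -
    have "real (Suc n) * y - 1 \<le> of_int \<lfloor>real (Suc n) * y\<rfloor>"
      "of_int \<lfloor>real (Suc n) * y\<rfloor> \<le> real (Suc n) * y" by linarith+
    then have "?a n y \<le> y" "(real (Suc n) * y - 1) / real (Suc n) \<le> ?a n y"
      by (auto simp del: of_nat_Suc simp: pos_divide_le_eq mult.commute intro!: divide_right_mono)
    then show ?thesis by (simp add: diff_divide_distrib inverse_eq_divide)
  qed
  show "\<forall>\<^sub>F n in sequentially. y - inverse (real (Suc n)) \<le> ?a n y"
    "\<forall>\<^sub>F n in sequentially. ?a n y \<le> y" using bds by auto
  show "(\<lambda>n. y - inverse (real (Suc n))) \<longlonglongrightarrow> y"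
    using tendsto_diff[OF tendsto_const LIMSEQ_inverse_real_of_nat] by simp
qed auto

text \<open>A function continuous in its real argument and measurable in the other one is jointly
  measurable.\<close>
lemma caratheodory_measurable:
  fixes g :: "real \<Rightarrow> 'b \<Rightarrow> 'c::metric_space"
  assumes cont: "\<And>\<xi>. \<xi> \<in> space M \<Longrightarrow> continuous_on UNIV (\<lambda>y. g y \<xi>)"
    and meas: "\<And>y. g y \<in> borel_measurable M"
  shows "(\<lambda>(y, \<xi>). g y \<xi>) \<in> borel_measurable (borel \<Otimes>\<^sub>M M)"
proof -
  let ?a = "\<lambda>(n::nat) (y::real). of_int \<lfloor>real (Suc n) * y\<rfloor> / real (Suc n) :: real"
  show ?thesis
  proof (rule borel_measurable_LIMSEQ_metric[where f = "\<lambda>n p. g (?a n (fst p)) (snd p)"])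
    show "(\<lambda>p. g (?a n (fst p)) (snd p)) \<in> borel_measurable (borel \<Otimes>\<^sub>M M)" for n
    proof -
      have "(\<lambda>p. (\<lambda>i p. g (of_int i / real (Suc n)) (snd p)) \<lfloor>real (Suc n) * fst p\<rfloor> p)
          \<in> borel_measurable (borel \<Otimes>\<^sub>M M)"
      proof (rule measurable_compose_countable[where f = "\<lambda>i p. g (of_int i / real (Suc n)) (snd p)"])
        show "(\<lambda>p. g (of_int i / real (Suc n)) (snd p)) \<in> borel_measurable (borel \<Otimes>\<^sub>M M)" for i :: int
          by (rule measurable_compose[OF measurable_snd meas])
        show "(\<lambda>p. \<lfloor>real (Suc n) * fst p\<rfloor>) \<in> borel \<Otimes>\<^sub>M M \<rightarrow>\<^sub>M count_space UNIV"
          by measurable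
      qed
      then show ?thesis by simp
    qed
    fix p :: "real \<times> 'b" assume "p \<in> space (borel \<Otimes>\<^sub>M M)"
    then obtain y \<xi> where p: "p = (y, \<xi>)" and \<xi>: "\<xi> \<in> space M" by (auto simp: space_pair_measure)
    have "(\<lambda>n. ?a n y) \<longlonglongrightarrow> y" by (rule floor_approx_tendsto)
    moreover have "isCont (\<lambda>y. g y \<xi>) y"
      using cont[OF \<xi>] by (simp add: continuous_on_eq_continuous_at)
    ultimately have "(\<lambda>n. g (?a n y) \<xi>) \<longlonglongrightarrow> g y \<xi>"
      using isCont_tendsto_compose by blast
    then show "(\<lambda>n. g (?a n (fst p)) (snd p)) \<longlonglongrightarrow> (\<lambda>(y, \<xi>). g y \<xi>) p"
      by (simp add: p)
  qed
qed

text \<open>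
  Continuous test functions of the parameter detect the sign of an integrable function: by inner
  regularity, \<open>{J < 0}\<close> would otherwise contain a compact set of positive measure, whose indicator
  is a limit of continuous functions.
\<close>
lemma AE_nonneg_of_continuous_tests:
  fixes \<Xi> :: "'b::euclidean_space set" and J :: "'b \<Rightarrow> real"
  assumes \<rho>: "prob_space \<rho>" and sets: "sets \<rho> = sets (restrict_space borel \<Xi>)" and \<Xi>: "compact \<Xi>"
    and J: "integrable \<rho> J"
    and test: "\<And>\<theta>. continuous_on UNIV \<theta> \<Longrightarrow> (\<And>\<xi>. 0 \<le> \<theta> \<xi>) \<Longrightarrow> 0 \<le> (LINT \<xi>|\<rho>. \<theta> \<xi> * J \<xi>)"
  shows "AE \<xi> in \<rho>. 0 \<le> J \<xi>"
proof -
  interpret prob_space \<rho> by fact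
  have \<Xi>_borel: "\<Xi> \<in> sets borel" using \<Xi> by (rule borel_compact)
  have space: "space \<rho> = \<Xi>" using sets_eq_imp_space_eq[OF sets] by (simp add: space_restrict_space)
  have id: "(\<lambda>\<xi>. \<xi>) \<in> \<rho> \<rightarrow>\<^sub>M borel"
    unfolding measurable_cong_sets[OF sets refl] by (rule measurable_restrict_space1) simp
  have [measurable]: "J \<in> borel_measurable \<rho>" using J by auto
  define N where "N = {\<xi> \<in> space \<rho>. J \<xi> < 0}"
  have N: "N \<in> sets \<rho>" unfolding N_def by measurable
  have "N \<in> sets borel"
    using N \<Xi>_borel unfolding sets by (auto simp: sets_restrict_space)
  define \<nu> where "\<nu> = distr \<rho> borel (\<lambda>\<xi>. \<xi>)"
  have \<nu>: "emeasure \<nu> A = emeasure \<rho> (A \<inter> space \<rho>)" if "A \<in> sets borel" for A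
    using that id by (simp add: \<nu>_def emeasure_distr)
  have K0: "emeasure \<nu> K = 0" if K: "K \<subseteq> N" "compact K" for K
  proof (cases "K = {}")
    case False
    have [simp]: "K \<in> sets borel" "closed K" "K \<inter> space \<rho> = K"
      using K borel_compact compact_imp_closed by (auto simp: N_def)
    have Ks: "K \<in> sets \<rho>" using measurable_sets[OF id, of K] by simp
    define \<theta> where "\<theta> n \<xi> = max 0 (1 - real n * infdist \<xi> K)" for n :: nat and \<xi>
    have \<theta>: "continuous_on UNIV (\<theta> n)" "0 \<le> \<theta> n \<xi>" "\<theta> n \<xi> \<le> 1" for n \<xi>
      by (auto simp: \<theta>_def infdist_nonneg intro!: continuous_intros)
    have lim: "(\<lambda>n. \<theta> n \<xi>) \<longlonglongrightarrow> indicator K \<xi>" for \<xi>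
    proof (cases "\<xi> \<in> K")
      case False
      have "0 < infdist \<xi> K"
        using False \<open>K \<noteq> {}\<close> by (metis \<open>closed K\<close> in_closed_iff_infdist_zero infdist_nonneg less_le)
      then obtain m :: nat where m: "1 < real m * infdist \<xi> K"
        using reals_Archimedean3 by blast
      have "\<forall>\<^sub>F n in sequentially. \<theta> n \<xi> = 0"
        using eventually_ge_at_top[of m]
      proof eventually_elim
        case (elim n)
        have "real m * infdist \<xi> K \<le> real n * infdist \<xi> K"
          using elim by (intro mult_right_mono) (auto simp: infdist_nonneg)
        then show ?case using m by (simp add: \<theta>_def)
      qed
      then show ?thesis using False by (simp add: tendsto_eventually)
    qed (simp add: \<theta>_def)
    have meas[measurable]: "\<theta> n \<in> borel_measurable \<rho>" for n
      using measurable_compose[OF id borel_measurable_continuous_onI[OF \<theta>(1)]] .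
    have "(\<lambda>n. LINT \<xi>|\<rho>. \<theta> n \<xi> * J \<xi>) \<longlonglongrightarrow> (LINT \<xi>|\<rho>. indicator K \<xi> * J \<xi>)"
    proof (rule integral_dominated_convergence[where w = "\<lambda>\<xi>. \<bar>J \<xi>\<bar>"])
      show "AE \<xi> in \<rho>. (\<lambda>n. \<theta> n \<xi> * J \<xi>) \<longlonglongrightarrow> indicator K \<xi> * J \<xi>"
        using lim by (intro AE_I2 tendsto_mult) auto
      show "AE \<xi> in \<rho>. norm (\<theta> n \<xi> * J \<xi>) \<le> \<bar>J \<xi>\<bar>" for n
        using \<theta> by (intro AE_I2) (auto simp: abs_mult intro: mult_left_le_one_le)
      show "(\<lambda>\<xi>. indicator K \<xi> * J \<xi>) \<in> borel_measurable \<rho>" using Ks by measurable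
    qed (use J in auto)
    moreover have "0 \<le> (LINT \<xi>|\<rho>. \<theta> n \<xi> * J \<xi>)" for n by (intro test \<theta>)
    ultimately have ge: "0 \<le> (LINT \<xi>|\<rho>. indicator K \<xi> * J \<xi>)"
      using LIMSEQ_le_const by blast
    have int: "integrable \<rho> (\<lambda>\<xi>. indicator K \<xi> * J \<xi>)"
      using integrable_real_mult_indicator[OF Ks J] by (simp add: mult.commute)
    have nn: "0 \<le> - (indicator K \<xi> * J \<xi>)" for \<xi>
      using K by (auto simp: N_def indicator_def less_imp_le)
    have "(LINT \<xi>|\<rho>. - (indicator K \<xi> * J \<xi>)) = 0"
      using ge Bochner_Integration.integral_nonneg[of \<rho> "\<lambda>\<xi>. - (indicator K \<xi> * J \<xi>)"] nn
      by (simp add: order_antisym)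
    then have "AE \<xi> in \<rho>. - (indicator K \<xi> * J \<xi>) = 0"
      using nn int by (subst (asm) integral_nonneg_eq_0_iff_AE) auto
    then have "AE \<xi> in \<rho>. \<xi> \<notin> K"
      by eventually_elim (use K in \<open>auto simp: N_def\<close>)
    then have "K \<in> null_sets \<rho>" by (simp add: AE_iff_null_sets[OF Ks])
    then show ?thesis using \<nu>[of K] by auto
  qed simp
  have "emeasure \<nu> N = (SUP K \<in> {K. K \<subseteq> N \<and> compact K}. emeasure \<nu> K)"
    using \<open>N \<in> sets borel\<close> prob_space.emeasure_space_1[OF prob_space_distr[OF id]]
    by (intro inner_regular) (auto simp: \<nu>_def)
  also have "\<dots> = 0" using K0 by (auto intro!: antisym SUP_least)
  finally have "emeasure \<rho> N = 0" using \<nu>[OF \<open>N \<in> sets borel\<close>] by (simp add: N_def inf.absorb1)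
  then show ?thesis
    using N by (intro AE_I'[of N]) (auto simp: N_def)
qed

section \<open>Jointly measurable versions of the data\<close>

lemma lebesgue_on_borel_version:
  fixes h :: "'a::euclidean_space \<Rightarrow> real"
  assumes h: "h \<in> borel_measurable (lebesgue_on S)" and S: "S \<in> sets borel"
  obtains h' where "h' \<in> borel_measurable lborel" "AE z in lebesgue_on S. h z = h' z"
proof -
  have SL: "S \<in> sets lebesgue" using S by auto
  have "(\<lambda>z. if z \<in> S then h z else 0) \<in> borel_measurable lebesgue"
    using h SL by (simp add: borel_measurable_if)
  from completion_ex_borel_measurable_real[OF this]
  obtain h' where h': "h' \<in> borel_measurable lborel"
    and ae: "AE z in lborel. (if z \<in> S then h z else 0) = h' z" by blast
  have "AE z in lebesgue. z \<in> S \<longrightarrow> h z = h' z"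
    unfolding AE_completion_iff using ae by eventually_elim auto
  then have "AE z in lebesgue_on S. h z = h' z"
    using SL by (subst AE_restrict_space_iff) auto
  with h' show thesis by (rule that)
qed

text \<open>
  The approximating simple maps take finitely many values, so that Borel versions of these values
  turn them into jointly measurable functions, and the pointwise limit is a version of \<open>U\<close>.
\<close>
lemma bochner_measurable_version:
  fixes U :: "'b \<Rightarrow> 'a::euclidean_space \<Rightarrow> real"
  assumes U: "bochner_measurable \<rho> (lebesgue_on S) U" and S: "S \<in> sets borel"
  obtains V where "(\<lambda>(z, \<xi>). V z \<xi>) \<in> borel_measurable (lborel \<Otimes>\<^sub>M \<rho>)"
    "AE \<xi> in \<rho>. AE z in lebesgue_on S. V z \<xi> = U \<xi> z"
proof -
  let ?M = "lebesgue_on S"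
  obtain s where s: "\<And>k. simple_function \<rho> (s k)" "\<And>k \<xi>. \<xi> \<in> space \<rho> \<Longrightarrow> s k \<xi> \<in> Linf ?M"
    and lim: "AE \<xi> in \<rho>. (\<lambda>k::nat. Linf_norm ?M (\<lambda>z. s k \<xi> z - U \<xi> z)) \<longlonglongrightarrow> 0"
    using U unfolding bochner_measurable_def by auto
  have "\<forall>h\<in>Linf ?M. \<exists>h'. h' \<in> borel_measurable lborel \<and> (AE z in ?M. h z = h' z)"
  proof
    fix h assume "h \<in> Linf ?M"
    then have "h \<in> borel_measurable ?M" by (simp add: Linf_def)
    from lebesgue_on_borel_version[OF this S]
    show "\<exists>h'. h' \<in> borel_measurable lborel \<and> (AE z in ?M. h z = h' z)" by blast
  qed
  then obtain b where b: "\<And>h. h \<in> Linf ?M \<Longrightarrow> b h \<in> borel_measurable lborel"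
    "\<And>h. h \<in> Linf ?M \<Longrightarrow> AE z in ?M. h z = b h z" by metis
  define v where "v k z \<xi> = b (s k \<xi>) z" for k z \<xi>
  have v: "(\<lambda>p. v k (fst p) (snd p)) \<in> borel_measurable (lborel \<Otimes>\<^sub>M \<rho>)" for k
    unfolding v_def
  proof (rule measurable_compose_countable'[where g = "\<lambda>p. s k (snd p)" and f = "\<lambda>h p. b h (fst p)"])
    show "countable (s k ` space \<rho>)"
      using s(1) by (simp add: simple_functionD countable_finite)
    show "(\<lambda>p. b h (fst p)) \<in> borel_measurable (lborel \<Otimes>\<^sub>M \<rho>)" if "h \<in> s k ` space \<rho>" for h
      using that s(2) by (intro measurable_compose[OF measurable_fst b(1)]) auto
    have "s k \<in> \<rho> \<rightarrow>\<^sub>M count_space (s k ` space \<rho>)"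
      using s(1)[of k] by (subst measurable_count_space_eq_countable)
        (auto simp: simple_functionD countable_finite)
    then show "(\<lambda>p. s k (snd p)) \<in> lborel \<Otimes>\<^sub>M \<rho> \<rightarrow>\<^sub>M count_space (s k ` space \<rho>)"
      by (rule measurable_compose[OF measurable_snd])
  qed
  define V where "V z \<xi> = lim (\<lambda>k. v k z \<xi>)" for z \<xi>
  have "(\<lambda>(z, \<xi>). V z \<xi>) \<in> borel_measurable (lborel \<Otimes>\<^sub>M \<rho>)"
    unfolding V_def case_prod_beta by (intro borel_measurable_lim_metric v)
  moreover have "AE \<xi> in \<rho>. AE z in ?M. V z \<xi> = U \<xi> z"
    using lim AE_space
  proof eventually_elim
    case (elim \<xi>)
    note lim\<xi> = elim(1)
    have "AE z in ?M. \<forall>k. ereal \<bar>s k \<xi> z - U \<xi> z\<bar> \<le> Linf_norm ?M (\<lambda>z. s k \<xi> z - U \<xi> z)"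
      unfolding AE_all_countable Linf_norm_def
      by (intro allI esssup_AE[where f = "\<lambda>z. ereal \<bar>s k \<xi> z - U \<xi> z\<bar>" for k])
    moreover have "AE z in ?M. \<forall>k. s k \<xi> z = v k z \<xi>"
      unfolding AE_all_countable v_def using b(2) s(2) elim(2) by blast
    ultimately show ?case
    proof eventually_elim
      case (elim z)
      have "(\<lambda>k. ereal \<bar>v k z \<xi> - U \<xi> z\<bar>) \<longlonglongrightarrow> 0"
      proof (rule tendsto_sandwich[OF _ _ tendsto_const lim\<xi>])
        show "\<forall>\<^sub>F k in sequentially. 0 \<le> ereal \<bar>v k z \<xi> - U \<xi> z\<bar>" by simp
        show "\<forall>\<^sub>F k in sequentially. ereal \<bar>v k z \<xi> - U \<xi> z\<bar> \<le> Linf_norm ?M (\<lambda>z. s k \<xi> z - U \<xi> z)"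
          using elim by (intro always_eventually) metis
      qed
      then have "(\<lambda>k. \<bar>v k z \<xi> - U \<xi> z\<bar>) \<longlonglongrightarrow> 0"
        by (simp add: zero_ereal_def)
      then have "(\<lambda>k. v k z \<xi>) \<longlonglongrightarrow> U \<xi> z"
        by (simp add: LIM_zero_iff tendsto_rabs_zero_iff)
      then show ?case unfolding V_def by (rule limI)
    qed
  qed
  ultimately show thesis by (rule that)
qed

text \<open>
  By continuity in the state, only countably many exceptional null sets matter: that of the
  \<open>C\<^sup>1\<close> property and those of the rational states. The flux is replaced by zero on their union.
\<close>
lemma flux_version:
  fixes f :: "real \<Rightarrow> 'b \<Rightarrow> 'c::euclidean_space"
  assumes meas: "\<And>w. f w \<in> borel_measurable (completion \<rho>)"
    and bound: "\<And>K. compact K \<Longrightarrow> \<exists>C::real. \<forall>w\<in>K. AE \<xi> in \<rho>. norm (f w \<xi>) \<le> C"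
    and C1: "AE \<xi> in \<rho>. (\<lambda>w. f w \<xi>) C1_differentiable_on UNIV"
  obtains g where "AE \<xi> in \<rho>. \<forall>w. g w \<xi> = f w \<xi>"
    "\<And>\<xi>. (\<lambda>w. g w \<xi>) C1_differentiable_on UNIV"
    "\<And>w. g w \<in> borel_measurable \<rho>"
    "\<And>r. \<exists>C. \<forall>w \<xi>. \<bar>w\<bar> \<le> r \<longrightarrow> norm (g w \<xi>) \<le> C"
proof -
  \<comment> \<open>Rational approximations of \<open>y\<close>, at distance at most \<open>1\<close>; hence the bound for radius \<open>r\<close> comes
    from the rational states of modulus at most \<open>r + 1\<close>.\<close>
  let ?a = "\<lambda>(n::nat) (y::real). of_int \<lfloor>real (Suc n) * y\<rfloor> / real (Suc n) :: real"
  have rat: "?a n y \<in> \<rat>" for n y by (intro Rats_divide) (simp_all del: of_nat_Suc)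
  have near: "\<bar>?a n y - y\<bar> \<le> 1" for n y
  proof -
    have "\<bar>of_int \<lfloor>real (Suc n) * y\<rfloor> - real (Suc n) * y\<bar> \<le> 1" by linarith
    also have "\<dots> \<le> real (Suc n)" by simp
    finally have "\<bar>of_int \<lfloor>real (Suc n) * y\<rfloor> - real (Suc n) * y\<bar> / real (Suc n) \<le> 1"
      by (simp del: of_nat_Suc add: pos_divide_le_eq)
    moreover have "?a n y - y = (of_int \<lfloor>real (Suc n) * y\<rfloor> - real (Suc n) * y) / real (Suc n)"
      by (simp del: of_nat_Suc add: diff_divide_distrib)
    ultimately show ?thesis by (simp del: of_nat_Suc)
  qed
  have "\<forall>w i. \<exists>h\<in>borel_measurable \<rho>. AE \<xi> in \<rho>. f w \<xi> \<bullet> i = h \<xi>"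
    using meas by (intro allI completion_ex_borel_measurable_real borel_measurable_inner) auto
  then obtain h where h: "\<And>w i. h w i \<in> borel_measurable \<rho>" "\<And>w i. AE \<xi> in \<rho>. f w \<xi> \<bullet> i = h w i \<xi>"
    by metis
  have "\<forall>m::nat. \<exists>C. \<forall>w\<in>{- real m..real m}. AE \<xi> in \<rho>. norm (f w \<xi>) \<le> C"
    using bound by blast
  then obtain C where C: "\<And>m w. w \<in> {- real m..real m} \<Longrightarrow> AE \<xi> in \<rho>. norm (f w \<xi>) \<le> C m"
    by metis
  let ?G = "\<lambda>\<xi>. (\<lambda>w. f w \<xi>) C1_differentiable_on UNIV \<and> (\<forall>w\<in>\<rat>. \<forall>i\<in>Basis. f w \<xi> \<bullet> i = h w i \<xi>) \<and>
    (\<forall>m. \<forall>w\<in>\<rat> \<inter> {- real m..real m}. norm (f w \<xi>) \<le> C m)"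
  have "AE \<xi> in \<rho>. \<forall>m. \<forall>w\<in>\<rat> \<inter> {- real m..real m}. norm (f w \<xi>) \<le> C m"
    unfolding AE_all_countable using C countable_rat
    by (intro allI AE_ball_countable'[of "\<rat> \<inter> {- real m..real m}" for m]) (auto intro: C)
  moreover have "AE \<xi> in \<rho>. \<forall>w\<in>\<rat>. \<forall>i\<in>Basis. f w \<xi> \<bullet> i = h w i \<xi>"
    using h(2) countable_rat by (intro AE_ball_countable' AE_finite_allI) auto
  ultimately have "AE \<xi> in \<rho>. ?G \<xi>"
    using C1 by eventually_elim blast
  then obtain N where N: "{\<xi> \<in> space \<rho>. \<not> ?G \<xi>} \<subseteq> N" "N \<in> null_sets \<rho>"
    unfolding eventually_ae_filter by blast
  define A where "A = space \<rho> - N"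
  have A: "A \<in> sets \<rho>" using N by (auto simp: A_def)
  have G: "?G \<xi>" if "\<xi> \<in> A" for \<xi> using N that unfolding A_def by blast
  define g where "g w \<xi> = (if \<xi> \<in> A then f w \<xi> else 0)" for w \<xi>
  have gC1: "(\<lambda>w. g w \<xi>) C1_differentiable_on UNIV" for \<xi>
    using G[of \<xi>] by (cases "\<xi> \<in> A") (auto simp: g_def)
  have glim: "(\<lambda>n. g (?a n w) \<xi>) \<longlonglongrightarrow> g w \<xi>" for w \<xi>
  proof -
    have "isCont (\<lambda>w. g w \<xi>) w"
      using C1_differentiable_imp_continuous_on[OF gC1] by (simp add: continuous_on_eq_continuous_at)
    then show ?thesis
      using isCont_tendsto_compose[OF _ floor_approx_tendsto] by blast
  qed
  have gmeas_rat: "g w \<in> borel_measurable \<rho>" if "w \<in> \<rat>" for w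
  proof (rule borel_measurable_euclidean_space[THEN iffD2], rule ballI)
    fix i :: 'c assume i: "i \<in> Basis"
    have "(\<lambda>\<xi>. g w \<xi> \<bullet> i) = (\<lambda>\<xi>. if \<xi> \<in> A then h w i \<xi> else 0)"
      using G that i by (auto simp: g_def)
    then show "(\<lambda>\<xi>. g w \<xi> \<bullet> i) \<in> borel_measurable \<rho>"
      using A h(1) by (simp add: measurable_If_set)
  qed
  have gmeas: "g w \<in> borel_measurable \<rho>" for w
    using gmeas_rat[OF rat] glim by (rule borel_measurable_LIMSEQ_metric)
  have "\<exists>B. \<forall>w \<xi>. \<bar>w\<bar> \<le> r \<longrightarrow> norm (g w \<xi>) \<le> B" for r
  proof -
    obtain m :: nat where m: "r + 1 \<le> real m" using real_arch_simple by blast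
    have "norm (g w \<xi>) \<le> max 0 (C m)" if w: "\<bar>w\<bar> \<le> r" for w \<xi>
    proof (rule LIMSEQ_le_const2[OF tendsto_norm[OF glim]], intro exI allI impI)
      fix n
      have "\<bar>?a n w\<bar> \<le> real m" using near[of n w] w m by linarith
      then have "- real m \<le> ?a n w" "?a n w \<le> real m" by linarith+
      then have "?a n w \<in> \<rat> \<inter> {- real m..real m}" using rat by (simp only: Int_iff atLeastAtMost_iff)
      then show "norm (g (?a n w) \<xi>) \<le> max 0 (C m)"
        using G[of \<xi>] by (cases "\<xi> \<in> A") (auto simp: g_def le_max_iff_disj simp del: of_nat_Suc)
    qed
    then show ?thesis by blast
  qed
  moreover have "AE \<xi> in \<rho>. \<forall>w. g w \<xi> = f w \<xi>"
    using AE_not_in[OF N(2)] AE_space by eventually_elim (auto simp: g_def A_def)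
  ultimately show thesis using gC1 gmeas by (intro that)
qed

section \<open>Bounded jointly measurable data\<close>

lemma measurable_continuous_on_Times:
  fixes \<Phi> :: "'b::euclidean_space \<Rightarrow> 'a::euclidean_space \<Rightarrow> 'c::euclidean_space"
  assumes "continuous_on (H \<times> \<Xi>) (\<lambda>(z, \<xi>). \<Phi> \<xi> z)" "H \<in> sets borel" "\<Xi> \<in> sets borel"
    and \<rho>: "sets \<rho> = sets (restrict_space borel \<Xi>)"
  shows "(\<lambda>p. indicator H (fst p) *\<^sub>R \<Phi> (snd p) (fst p)) \<in> borel_measurable (lborel \<Otimes>\<^sub>M \<rho>)"
proof -
  have space: "space \<rho> = \<Xi>" using sets_eq_imp_space_eq[OF \<rho>] by (simp add: space_restrict_space)
  have id: "(\<lambda>\<xi>. \<xi>) \<in> \<rho> \<rightarrow>\<^sub>M borel"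
    unfolding measurable_cong_sets[OF \<rho> refl] by (rule measurable_restrict_space1) simp
  have "(\<lambda>p. p) \<in> lborel \<Otimes>\<^sub>M \<rho> \<rightarrow>\<^sub>M (borel \<Otimes>\<^sub>M borel :: ('a \<times> 'b) measure)"
    using measurable_Pair[OF measurable_compose[OF measurable_fst measurable_ident_sets[OF sets_lborel]]
      measurable_compose[OF measurable_snd id]]
    by simp
  then have id2: "(\<lambda>p. p) \<in> lborel \<Otimes>\<^sub>M \<rho> \<rightarrow>\<^sub>M (borel :: ('a \<times> 'b) measure)"
    by (simp add: borel_prod)
  have "(\<lambda>p. indicator (H \<times> \<Xi>) p *\<^sub>R (case p of (z, \<xi>) \<Rightarrow> \<Phi> \<xi> z)) \<in> borel_measurable borel"
    using assms by (intro borel_measurable_continuous_on_indicator)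
      (auto simp: borel_prod[symmetric])
  from measurable_compose[OF id2 this] show ?thesis
    by (rule measurable_cong[THEN iffD1, rotated])
      (auto simp: space_pair_measure space indicator_def)
qed

text \<open>
  The situation after passing to versions: a state \<open>w\<close>, an initial state \<open>w\<^sub>0\<close> and a flux \<open>g\<close> that
  are jointly measurable and (locally) bounded everywhere.
\<close>
locale bounded_data =
  fixes \<Xi> :: "'b::euclidean_space set" and \<rho> :: "'b measure"
    and g :: "real \<Rightarrow> 'b \<Rightarrow> real ^ 'n"
    and w :: "real \<times> (real ^ 'n) \<Rightarrow> 'b \<Rightarrow> real" and w\<^sub>0 :: "real ^ 'n \<Rightarrow> 'b \<Rightarrow> real"
    and M :: real
  assumes \<Xi>: "compact \<Xi>" and \<rho>: "prob_space \<rho>"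
    and sets_\<rho>: "sets \<rho> = sets (restrict_space borel \<Xi>)"
    and g_meas: "(\<lambda>(y, \<xi>). g y \<xi>) \<in> borel_measurable (borel \<Otimes>\<^sub>M \<rho>)"
    and g_bound: "\<And>r. \<exists>C. \<forall>y \<xi>. \<bar>y\<bar> \<le> r \<longrightarrow> norm (g y \<xi>) \<le> C"
    and w_meas: "(\<lambda>(z, \<xi>). w z \<xi>) \<in> borel_measurable (lborel \<Otimes>\<^sub>M \<rho>)"
    and w_bound: "\<And>z \<xi>. \<bar>w z \<xi>\<bar> \<le> M"
    and w\<^sub>0_meas: "(\<lambda>(x, \<xi>). w\<^sub>0 x \<xi>) \<in> borel_measurable (lborel \<Otimes>\<^sub>M \<rho>)"
    and w\<^sub>0_bound: "\<And>x \<xi>. \<bar>w\<^sub>0 x \<xi>\<bar> \<le> M"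
begin

sublocale prob_space \<rho> by (rule \<rho>)

sublocale Z: pair_sigma_finite "lborel :: (real \<times> (real ^ 'n)) measure" \<rho> ..

sublocale X: pair_sigma_finite "lborel :: (real ^ 'n) measure" \<rho> ..

lemma space_\<rho>: "space \<rho> = \<Xi>"
  using sets_eq_imp_space_eq[OF sets_\<rho>] by (simp add: space_restrict_space)

lemma \<Xi>_borel: "\<Xi> \<in> sets borel" using \<Xi> by (rule borel_compact)

text \<open>The integrand of the Kruzhkov inequality, extended by zero outside the half space.\<close>
definition kernel :: "real \<Rightarrow> (real \<times> (real ^ 'n) \<Rightarrow> real) \<Rightarrow> real \<times> (real ^ 'n) \<Rightarrow> 'b \<Rightarrow> real" where
  "kernel v \<psi> z \<xi> = indicator half_space z * (time_deriv \<psi> z * \<bar>w z \<xi> - v\<bar>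
     + space_grad \<psi> z \<bullet> (sgn (w z \<xi> - v) *\<^sub>R (g (w z \<xi>) \<xi> - g v \<xi>)))"

text \<open>The integrand of the initial term.\<close>
definition init :: "real \<Rightarrow> (real \<times> (real ^ 'n) \<Rightarrow> real) \<Rightarrow> real ^ 'n \<Rightarrow> 'b \<Rightarrow> real" where
  "init v \<psi> x \<xi> = \<psi> (0, x) * \<bar>w\<^sub>0 x \<xi> - v\<bar>"

text \<open>The left-hand side of the entropy inequality for the test function \<open>\<psi>\<close> at the parameter \<open>\<xi>\<close>.\<close>
definition J :: "real \<Rightarrow> (real \<times> (real ^ 'n) \<Rightarrow> real) \<Rightarrow> 'b \<Rightarrow> real" where
  "J v \<psi> \<xi> = (LINT z|lborel. kernel v \<psi> z \<xi>) + (LINT x|lborel. init v \<psi> x \<xi>)"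

lemma C_C1c_continuous:
  assumes \<phi>: "\<phi> \<in> C_C1c \<Xi>"
  shows "continuous_on (half_space \<times> \<Xi>) (\<lambda>(z, \<xi>). \<phi> \<xi> z)"
    "continuous_on (half_space \<times> \<Xi>) (\<lambda>(z, \<xi>). time_deriv (\<phi> \<xi>) z)"
    "continuous_on (half_space \<times> \<Xi>) (\<lambda>(z, \<xi>). space_grad (\<phi> \<xi>) z)"
  using \<phi> unfolding C_C1c_def
  by (auto intro!: continuous_on_Times_uniform_limit dest: C1_on_continuous)

lemma kernel_measurable:
  assumes \<phi>: "\<phi> \<in> C_C1c \<Xi>"
  shows "(\<lambda>(z, \<xi>). kernel v (\<phi> \<xi>) z \<xi>) \<in> borel_measurable (lborel \<Otimes>\<^sub>M \<rho>)"
proof -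
  have [measurable]: "(\<lambda>p. w (fst p) (snd p)) \<in> borel_measurable (lborel \<Otimes>\<^sub>M \<rho>)"
    using w_meas by (simp add: case_prod_beta)
  have t[measurable]: "(\<lambda>p. indicator half_space (fst p) *\<^sub>R time_deriv (\<phi> (snd p)) (fst p))
      \<in> borel_measurable (lborel \<Otimes>\<^sub>M \<rho>)"
    by (rule measurable_continuous_on_Times[OF C_C1c_continuous(2)[OF \<phi>] half_space_borel \<Xi>_borel sets_\<rho>])
  have s[measurable]: "(\<lambda>p. indicator half_space (fst p) *\<^sub>R space_grad (\<phi> (snd p)) (fst p))
      \<in> borel_measurable (lborel \<Otimes>\<^sub>M \<rho>)"
    by (rule measurable_continuous_on_Times[OF C_C1c_continuous(3)[OF \<phi>] half_space_borel \<Xi>_borel sets_\<rho>])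
  have [measurable]: "(\<lambda>p. g (w (fst p) (snd p)) (snd p)) \<in> borel_measurable (lborel \<Otimes>\<^sub>M \<rho>)"
    using measurable_compose[OF _ g_meas, of "\<lambda>p. (w (fst p) (snd p), snd p)" "lborel \<Otimes>\<^sub>M \<rho>"] by simp
  have [measurable]: "(\<lambda>p. g v (snd p)) \<in> borel_measurable (lborel \<Otimes>\<^sub>M \<rho>)"
    using measurable_compose[OF _ g_meas, of "\<lambda>p. (v, snd p)" "lborel \<Otimes>\<^sub>M \<rho>"] by simp
  have "(\<lambda>p. (indicator half_space (fst p) *\<^sub>R time_deriv (\<phi> (snd p)) (fst p)) * \<bar>w (fst p) (snd p) - v\<bar>
     + (indicator half_space (fst p) *\<^sub>R space_grad (\<phi> (snd p)) (fst p)) \<bullet>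
       (sgn (w (fst p) (snd p) - v) *\<^sub>R (g (w (fst p) (snd p)) (snd p) - g v (snd p))))
     \<in> borel_measurable (lborel \<Otimes>\<^sub>M \<rho>)"
    by (intro borel_measurable_add borel_measurable_times borel_measurable_inner t s) measurable
  then show ?thesis
    unfolding kernel_def by (simp add: case_prod_beta distrib_left ac_simps)
qed

lemma init_measurable:
  assumes \<phi>: "\<phi> \<in> C_C1c \<Xi>"
  shows "(\<lambda>(x, \<xi>). init v (\<phi> \<xi>) x \<xi>) \<in> borel_measurable (lborel \<Otimes>\<^sub>M \<rho>)"
proof -
  have [measurable]: "(\<lambda>p. w\<^sub>0 (fst p) (snd p)) \<in> borel_measurable (lborel \<Otimes>\<^sub>M \<rho>)"
    using w\<^sub>0_meas by (simp add: case_prod_beta)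
  have "continuous_on (UNIV \<times> \<Xi>) (\<lambda>p. (\<lambda>(z, \<xi>). \<phi> \<xi> z) ((0, fst p), snd p))"
    by (rule continuous_on_compose2[OF C_C1c_continuous(1)[OF \<phi>]]) (auto intro!: continuous_intros)
  then have "continuous_on (UNIV \<times> \<Xi>) (\<lambda>(x, \<xi>). \<phi> \<xi> (0, x))"
    by (simp add: case_prod_beta)
  from measurable_continuous_on_Times[OF this _ \<Xi>_borel sets_\<rho>]
  have [measurable]: "(\<lambda>p. \<phi> (snd p) (0, fst p)) \<in> borel_measurable (lborel \<Otimes>\<^sub>M \<rho>)" by simp
  show ?thesis unfolding init_def case_prod_beta by measurable
qed

text \<open>
  The parameter of the test function is decoupled from that of the state, since test functions
  at neighbouring parameters are compared at a fixed parameter of the state.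
\<close>
lemma kernel_init_bound:
  assumes \<phi>: "\<phi> \<in> C_C1c \<Xi>"
  obtains K B where "compact K" "K \<subseteq> half_space" "\<And>\<xi>. \<xi> \<in> \<Xi> \<Longrightarrow> \<phi> \<xi> \<in> C1_on K"
    "\<And>\<xi> \<xi>' z. \<xi> \<in> \<Xi> \<Longrightarrow> \<bar>kernel v (\<phi> \<xi>) z \<xi>'\<bar> \<le> B * indicator K z"
    "\<And>\<xi> \<xi>' x. \<xi> \<in> \<Xi> \<Longrightarrow> \<bar>init v (\<phi> \<xi>) x \<xi>'\<bar> \<le> B * indicator (snd ` K) x"
proof -
  obtain K where K: "compact K" "K \<subseteq> half_space" and \<phi>K: "\<And>\<xi>. \<xi> \<in> \<Xi> \<Longrightarrow> \<phi> \<xi> \<in> C1_on K"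
    using \<phi> unfolding C_C1c_def by blast
  note zero = C1_on_derivs_zero[OF \<phi>K compact_imp_closed[OF K(1)]]
  have zero0: "\<phi> \<xi> z = 0" if "\<xi> \<in> \<Xi>" "z \<in> half_space - K" for \<xi> z
    using \<phi>K[OF that(1)] that(2) by (auto simp: C1_on_def)
  obtain B0 where B0: "0 \<le> B0" "\<And>\<xi> z. \<xi> \<in> \<Xi> \<Longrightarrow> z \<in> half_space \<Longrightarrow> norm (\<phi> \<xi> z) \<le> B0"
    using bounded_compact_support_Times[OF C_C1c_continuous(1)[OF \<phi>] K \<Xi> zero0] by blast
  obtain B1 where B1: "0 \<le> B1"
    "\<And>\<xi> z. \<xi> \<in> \<Xi> \<Longrightarrow> z \<in> half_space \<Longrightarrow> norm (time_deriv (\<phi> \<xi>) z) \<le> B1"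
    using bounded_compact_support_Times[OF C_C1c_continuous(2)[OF \<phi>] K \<Xi> zero(1)] by blast
  obtain B2 where B2: "0 \<le> B2"
    "\<And>\<xi> z. \<xi> \<in> \<Xi> \<Longrightarrow> z \<in> half_space \<Longrightarrow> norm (space_grad (\<phi> \<xi>) z) \<le> B2"
    using bounded_compact_support_Times[OF C_C1c_continuous(3)[OF \<phi>] K \<Xi> zero(2)] by blast
  obtain C where C: "\<And>y \<xi>. \<bar>y\<bar> \<le> max M \<bar>v\<bar> \<Longrightarrow> norm (g y \<xi>) \<le> C" using g_bound by blast
  have M: "0 \<le> M" using w_bound[of undefined undefined] by linarith
  define B where "B = max (B1 * (M + \<bar>v\<bar>) + B2 * (2 * C)) (B0 * (M + \<bar>v\<bar>))"
  have "\<bar>kernel v (\<phi> \<xi>) z \<xi>'\<bar> \<le> B * indicator K z" if \<xi>: "\<xi> \<in> \<Xi>" for \<xi> \<xi>' z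
  proof (cases "z \<in> K")
    case True
    then have z: "z \<in> half_space" using K by auto
    have "norm (sgn (w z \<xi>' - v) *\<^sub>R (g (w z \<xi>') \<xi>' - g v \<xi>')) \<le> norm (g (w z \<xi>') \<xi>' - g v \<xi>')"
      by (auto simp: sgn_real_def)
    also have "\<dots> \<le> norm (g (w z \<xi>') \<xi>') + norm (g v \<xi>')" by (rule norm_triangle_ineq4)
    also have "\<dots> \<le> 2 * C"
      using C[of "w z \<xi>'" \<xi>'] C[of v \<xi>'] w_bound[of z \<xi>'] by (simp add: le_max_iff_disj)
    finally have q: "norm (sgn (w z \<xi>' - v) *\<^sub>R (g (w z \<xi>') \<xi>' - g v \<xi>')) \<le> 2 * C" .
    have "\<bar>time_deriv (\<phi> \<xi>) z * \<bar>w z \<xi>' - v\<bar>\<bar> \<le> B1 * (M + \<bar>v\<bar>)"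
      using B1(2)[OF \<xi> z] w_bound[of z \<xi>'] B1(1) by (simp add: abs_mult) (intro mult_mono; simp)
    moreover have "\<bar>space_grad (\<phi> \<xi>) z \<bullet> (sgn (w z \<xi>' - v) *\<^sub>R (g (w z \<xi>') \<xi>' - g v \<xi>'))\<bar> \<le> B2 * (2 * C)"
      using Cauchy_Schwarz_ineq2 mult_mono[OF B2(2)[OF \<xi> z] q B2(1) norm_ge_zero] order_trans by blast
    ultimately show ?thesis using True z by (simp add: kernel_def B_def)
  next
    case False
    then show ?thesis
      using zero[OF \<xi>, of z] by (cases "z \<in> half_space") (auto simp: kernel_def)
  qed
  moreover have "\<bar>init v (\<phi> \<xi>) x \<xi>'\<bar> \<le> B * indicator (snd ` K) x" if \<xi>: "\<xi> \<in> \<Xi>" for \<xi> \<xi>' x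
  proof (cases "(0, x) \<in> K")
    case True
    have "\<bar>\<phi> \<xi> (0, x)\<bar> * \<bar>w\<^sub>0 x \<xi>' - v\<bar> \<le> B0 * (M + \<bar>v\<bar>)"
      using B0(2)[OF \<xi>, of "(0, x)"] w\<^sub>0_bound[of x \<xi>'] B0(1) by (intro mult_mono) auto
    moreover have "x \<in> snd ` K" using True by force
    ultimately show ?thesis by (simp add: init_def B_def abs_mult)
  next
    case False
    have "0 \<le> B" using B0(1) M by (auto simp: B_def le_max_iff_disj)
    then show ?thesis using zero0[OF \<xi>, of "(0, x)"] False by (simp add: init_def)
  qed
  ultimately show thesis using K \<phi>K by (intro that[of K B])
qed

lemma indicator_bound:
  assumes "\<bar>h z\<bar> \<le> B * indicator S z"
  shows "norm (h z) \<le> \<bar>B\<bar>" and "z \<notin> S \<Longrightarrow> h z = (0::real)"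
  using assms by (cases "z \<in> S"; simp)+

lemma kernel_init_integrable_pair:
  assumes \<phi>: "\<phi> \<in> C_C1c \<Xi>"
  shows "integrable (lborel \<Otimes>\<^sub>M \<rho>) (\<lambda>(z, \<xi>). kernel v (\<phi> \<xi>) z \<xi>)"
    "integrable (lborel \<Otimes>\<^sub>M \<rho>) (\<lambda>(x, \<xi>). init v (\<phi> \<xi>) x \<xi>)"
proof -
  obtain K B where K: "compact K" "K \<subseteq> half_space"
    and b1: "\<And>\<xi> \<xi>' z. \<xi> \<in> \<Xi> \<Longrightarrow> \<bar>kernel v (\<phi> \<xi>) z \<xi>'\<bar> \<le> B * indicator K z"
    and b2: "\<And>\<xi> \<xi>' x. \<xi> \<in> \<Xi> \<Longrightarrow> \<bar>init v (\<phi> \<xi>) x \<xi>'\<bar> \<le> B * indicator (snd ` K) x"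
    using kernel_init_bound[OF \<phi>] by metis
  have "compact (snd ` K)" using K by (intro compact_continuous_image continuous_intros)
  then show "integrable (lborel \<Otimes>\<^sub>M \<rho>) (\<lambda>(x, \<xi>). init v (\<phi> \<xi>) x \<xi>)"
    using init_measurable[OF \<phi>] indicator_bound[of "\<lambda>x. init v (\<phi> \<xi>) x \<xi>'" for \<xi> \<xi>', OF b2]
    by (intro integrable_compact_support_pair[OF \<rho>, where B = "\<bar>B\<bar>" and K = "snd ` K"])
      (simp_all add: space_\<rho>)
  show "integrable (lborel \<Otimes>\<^sub>M \<rho>) (\<lambda>(z, \<xi>). kernel v (\<phi> \<xi>) z \<xi>)"
    using kernel_measurable[OF \<phi>] indicator_bound[of "\<lambda>z. kernel v (\<phi> \<xi>) z \<xi>'" for \<xi> \<xi>', OF b1] K(1)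
    by (intro integrable_compact_support_pair[OF \<rho>, where B = "\<bar>B\<bar>" and K = K])
      (simp_all add: space_\<rho>)
qed

lemma section_measurable:
  assumes \<psi>: "\<psi> \<in> C1_on K" "compact K" "K \<subseteq> half_space" and \<xi>: "\<xi> \<in> \<Xi>"
  shows "(\<lambda>z. kernel v \<psi> z \<xi>) \<in> borel_measurable lborel"
    "(\<lambda>x. init v \<psi> x \<xi>) \<in> borel_measurable lborel"
  using measurable_compose[OF _ kernel_measurable[OF const_in_C_C1c[OF \<psi>]], of "\<lambda>z. (z, \<xi>)" lborel]
    measurable_compose[OF _ init_measurable[OF const_in_C_C1c[OF \<psi>]], of "\<lambda>x. (x, \<xi>)" lborel] \<xi>
  by (auto simp: space_\<rho>)

lemma section_integrable:
  assumes \<psi>: "\<psi> \<in> C1_on K" "compact K" "K \<subseteq> half_space" and \<xi>: "\<xi> \<in> \<Xi>"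
  shows "integrable lborel (\<lambda>z. kernel v \<psi> z \<xi>)" "integrable lborel (\<lambda>x. init v \<psi> x \<xi>)"
proof -
  obtain K' B where K': "compact K'"
    and b1: "\<And>z. \<bar>kernel v \<psi> z \<xi>\<bar> \<le> B * indicator K' z"
    and b2: "\<And>x. \<bar>init v \<psi> x \<xi>\<bar> \<le> B * indicator (snd ` K') x"
    using kernel_init_bound[OF const_in_C_C1c[OF \<psi>]] \<xi> by metis
  have "compact (snd ` K')" using K' by (intro compact_continuous_image continuous_intros)
  then show "integrable lborel (\<lambda>x. init v \<psi> x \<xi>)"
    using section_measurable(2)[OF assms] indicator_bound[of "\<lambda>x. init v \<psi> x \<xi>", OF b2]
    by (intro integrable_compact_support[where B = "\<bar>B\<bar>" and K = "snd ` K'"]) simp_all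
  show "integrable lborel (\<lambda>z. kernel v \<psi> z \<xi>)"
    using section_measurable(1)[OF assms] indicator_bound[of "\<lambda>z. kernel v \<psi> z \<xi>", OF b1] K'
    by (intro integrable_compact_support[where B = "\<bar>B\<bar>" and K = K']) simp_all
qed

lemma J_integrable:
  assumes \<phi>: "\<phi> \<in> C_C1c \<Xi>"
  shows "integrable \<rho> (\<lambda>\<xi>. J v (\<phi> \<xi>) \<xi>)"
  unfolding J_def using kernel_init_integrable_pair[OF \<phi>, of v]
  by (intro Bochner_Integration.integrable_add Z.integrable_snd X.integrable_snd)

lemma J_eq_iterated:
  assumes \<psi>: "\<psi> \<in> C1_on K" "compact K" "K \<subseteq> half_space" and \<xi>: "\<xi> \<in> \<Xi>"
  shows "(LINT t|lebesgue_on {0..}. LINT x|lebesgue. time_deriv \<psi> (t, x) * \<bar>w (t, x) \<xi> - v\<bar>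
      + space_grad \<psi> (t, x) \<bullet> (sgn (w (t, x) \<xi> - v) *\<^sub>R (g (w (t, x) \<xi>) \<xi> - g v \<xi>)))
    + (LINT x|lebesgue. \<psi> (0, x) * \<bar>w\<^sub>0 x \<xi> - v\<bar>) = J v \<psi> \<xi>"
proof -
  have "(LINT t|lebesgue_on {0..}. LINT x|lebesgue. time_deriv \<psi> (t, x) * \<bar>w (t, x) \<xi> - v\<bar>
      + space_grad \<psi> (t, x) \<bullet> (sgn (w (t, x) \<xi> - v) *\<^sub>R (g (w (t, x) \<xi>) \<xi> - g v \<xi>)))
    = (LINT t|lebesgue_on {0..}. LINT x|lebesgue. kernel v \<psi> (t, x) \<xi>)"
    by (intro Bochner_Integration.integral_cong refl) (simp add: kernel_def)
  also have "\<dots> = (LINT z|lborel. kernel v \<psi> z \<xi>)"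
    by (intro integral_half_space_iterated section_integrable[OF assms]) (simp add: kernel_def)
  finally show ?thesis
    using integral_completion[OF section_measurable(2)[OF assms], of v] by (simp add: J_def init_def)
qed

lemma integral_J_eq_iterated:
  assumes \<phi>: "\<phi> \<in> C_C1c \<Xi>"
  shows "(LINT t|lebesgue_on {0..}. LINT x|lebesgue. LINT \<xi>|completion \<rho>.
        time_deriv (\<phi> \<xi>) (t, x) * \<bar>w (t, x) \<xi> - v\<bar>
        + space_grad (\<phi> \<xi>) (t, x) \<bullet> (sgn (w (t, x) \<xi> - v) *\<^sub>R (g (w (t, x) \<xi>) \<xi> - g v \<xi>)))
      + (LINT x|lebesgue. LINT \<xi>|completion \<rho>. \<phi> \<xi> (0, x) * \<bar>w\<^sub>0 x \<xi> - v\<bar>)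
    = (LINT \<xi>|\<rho>. J v (\<phi> \<xi>) \<xi>)"
proof -
  note int = kernel_init_integrable_pair[OF \<phi>, of v]
  have k: "(LINT \<xi>|completion \<rho>. kernel v (\<phi> \<xi>) z \<xi>) = (LINT \<xi>|\<rho>. kernel v (\<phi> \<xi>) z \<xi>)" for z
    using measurable_compose[OF measurable_Pair1' kernel_measurable[OF \<phi>, of v], of z]
    by (intro integral_completion) simp
  have i: "(LINT \<xi>|completion \<rho>. init v (\<phi> \<xi>) x \<xi>) = (LINT \<xi>|\<rho>. init v (\<phi> \<xi>) x \<xi>)" for x
    using measurable_compose[OF measurable_Pair1' init_measurable[OF \<phi>, of v], of x]
    by (intro integral_completion) simp
  have "(LINT t|lebesgue_on {0..}. LINT x|lebesgue. LINT \<xi>|completion \<rho>.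
        time_deriv (\<phi> \<xi>) (t, x) * \<bar>w (t, x) \<xi> - v\<bar>
        + space_grad (\<phi> \<xi>) (t, x) \<bullet> (sgn (w (t, x) \<xi> - v) *\<^sub>R (g (w (t, x) \<xi>) \<xi> - g v \<xi>)))
    = (LINT t|lebesgue_on {0..}. LINT x|lebesgue. LINT \<xi>|completion \<rho>. kernel v (\<phi> \<xi>) (t, x) \<xi>)"
    by (intro Bochner_Integration.integral_cong refl) (simp add: kernel_def)
  also have "\<dots> = (LINT t|lebesgue_on {0..}. LINT x|lebesgue. LINT \<xi>|\<rho>. kernel v (\<phi> \<xi>) (t, x) \<xi>)"
    by (simp only: k)
  also have "\<dots> = (LINT z|lborel. LINT \<xi>|\<rho>. kernel v (\<phi> \<xi>) z \<xi>)"
    by (intro integral_half_space_iterated Z.integrable_fst int) (simp add: kernel_def)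
  also have "\<dots> = (LINT \<xi>|\<rho>. LINT z|lborel. kernel v (\<phi> \<xi>) z \<xi>)"
    using Z.Fubini_integral[OF int(1)] by simp
  finally have 1: "(LINT t|lebesgue_on {0..}. LINT x|lebesgue. LINT \<xi>|completion \<rho>.
        time_deriv (\<phi> \<xi>) (t, x) * \<bar>w (t, x) \<xi> - v\<bar>
        + space_grad (\<phi> \<xi>) (t, x) \<bullet> (sgn (w (t, x) \<xi> - v) *\<^sub>R (g (w (t, x) \<xi>) \<xi> - g v \<xi>)))
      = (LINT \<xi>|\<rho>. LINT z|lborel. kernel v (\<phi> \<xi>) z \<xi>)" .
  have "(LINT x|lebesgue. LINT \<xi>|completion \<rho>. \<phi> \<xi> (0, x) * \<bar>w\<^sub>0 x \<xi> - v\<bar>) =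
      (LINT x|lebesgue. LINT \<xi>|\<rho>. init v (\<phi> \<xi>) x \<xi>)"
    by (simp only: i[symmetric]) (simp add: init_def)
  also have "\<dots> = (LINT x|lborel. LINT \<xi>|\<rho>. init v (\<phi> \<xi>) x \<xi>)"
    using X.integrable_fst[OF int(2)] by (intro integral_completion) (rule borel_measurable_integrable)
  also have "\<dots> = (LINT \<xi>|\<rho>. LINT x|lborel. init v (\<phi> \<xi>) x \<xi>)"
    using X.Fubini_integral[OF int(2)] by simp
  finally show ?thesis
    unfolding 1 J_def using Z.integrable_snd[OF int(1)] X.integrable_snd[OF int(2)] by simp
qed

lemma parametric_iff_J:
  "parametric_entropy_solution \<rho> (kruzhkov_family g) w\<^sub>0 (\<lambda>t x. w (t, x)) \<longleftrightarrow>
   (\<forall>v. \<forall>\<psi>\<in>C1c. (\<forall>z\<in>half_space. 0 \<le> \<psi> z) \<longrightarrow> (AE \<xi> in \<rho>. 0 \<le> J v \<psi> \<xi>))"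
proof -
  have "(\<lambda>z. w z \<xi>) \<in> Linf (lebesgue_on half_space)" if "\<xi> \<in> space \<rho>" for \<xi>
  proof -
    have "(\<lambda>z. w z \<xi>) \<in> borel_measurable lborel"
      using measurable_compose[OF measurable_Pair2'[OF that] w_meas] by simp
    then have "(\<lambda>z. w z \<xi>) \<in> borel_measurable (lebesgue_on half_space)"
      by (intro measurable_restrict_space1 measurable_completion)
    then show ?thesis using w_bound by (auto simp: Linf_def intro!: exI[of _ M])
  qed
  then have "AE \<xi> in \<rho>. (\<lambda>(t, x). w (t, x) \<xi>) \<in> Linf (lebesgue_on half_space)"
    by (intro AE_I2) (simp add: case_prod_eta[of "\<lambda>z. w z \<xi>" for \<xi>])
  moreover have "(AE \<xi> in \<rho>. (LINT t|lebesgue_on {0..}. LINT x|lebesgue.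
        time_deriv \<psi> (t, x) * \<bar>w (t, x) \<xi> - v\<bar>
        + space_grad \<psi> (t, x) \<bullet> (sgn (w (t, x) \<xi> - v) *\<^sub>R (g (w (t, x) \<xi>) \<xi> - g v \<xi>)))
      + (LINT x|lebesgue. \<psi> (0, x) * \<bar>w\<^sub>0 x \<xi> - v\<bar>) \<ge> 0) \<longleftrightarrow> (AE \<xi> in \<rho>. 0 \<le> J v \<psi> \<xi>)"
    if "\<psi> \<in> C1c" for v \<psi>
    using that J_eq_iterated[of \<psi>] by (intro AE_cong) (auto simp: C1c_def space_\<rho>)
  ultimately show ?thesis
    unfolding parametric_entropy_solution_def kruzhkov_family_def by (simp del: inner_scaleR_right)
qed

lemma weak_rep_iff_J:
  "weak_parametric_entropy_solution_rep \<rho> (kruzhkov_family g) w\<^sub>0 (\<lambda>t x. w (t, x)) \<longleftrightarrow>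
   (\<forall>v. \<forall>\<phi>\<in>C_C1c \<Xi>. (\<forall>\<xi>\<in>\<Xi>. \<forall>z\<in>half_space. 0 \<le> \<phi> \<xi> z) \<longrightarrow> 0 \<le> (LINT \<xi>|\<rho>. J v (\<phi> \<xi>) \<xi>))"
proof -
  have id: "(\<lambda>p. p) \<in> lebesgue_on half_space \<Otimes>\<^sub>M \<rho> \<rightarrow>\<^sub>M lborel \<Otimes>\<^sub>M \<rho>"
    using measurable_Pair[OF measurable_compose[OF measurable_fst] measurable_snd,
      of "\<lambda>z. z" "lebesgue_on half_space" lborel \<rho>]
    by (simp add: measurable_restrict_space1 measurable_completion)
  have "(\<lambda>((t, x), \<xi>). w (t, x) \<xi>) \<in> Linf (completion (lebesgue_on half_space \<Otimes>\<^sub>M \<rho>))"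
    using measurable_completion[OF measurable_compose[OF id w_meas]] w_bound
    by (auto simp: Linf_def case_prod_beta intro!: exI[of _ M])
  then show ?thesis
    unfolding weak_parametric_entropy_solution_rep_def kruzhkov_family_def
    by (simp add: integral_J_eq_iterated space_\<rho> del: inner_scaleR_right)
qed

end

section \<open>Pointwise and integrated inequalities\<close>

context bounded_data
begin

lemma J_tendsto:
  assumes \<phi>: "\<phi> \<in> C_C1c \<Xi>" and \<xi>: "\<xi> \<in> \<Xi>" and s: "\<And>k. s k \<in> \<Xi>" "s \<longlonglongrightarrow> \<xi>"
  shows "(\<lambda>k. J v (\<phi> (s k)) \<xi>) \<longlonglongrightarrow> J v (\<phi> \<xi>) \<xi>"
proof -
  obtain K B where K: "compact K" "K \<subseteq> half_space" and \<phi>K: "\<And>\<xi>. \<xi> \<in> \<Xi> \<Longrightarrow> \<phi> \<xi> \<in> C1_on K"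
    and b1: "\<And>\<xi> \<xi>' z. \<xi> \<in> \<Xi> \<Longrightarrow> \<bar>kernel v (\<phi> \<xi>) z \<xi>'\<bar> \<le> B * indicator K z"
    and b2: "\<And>\<xi> \<xi>' x. \<xi> \<in> \<Xi> \<Longrightarrow> \<bar>init v (\<phi> \<xi>) x \<xi>'\<bar> \<le> B * indicator (snd ` K) x"
    using kernel_init_bound[OF \<phi>] by metis
  have K0: "compact (snd ` K)" using K by (intro compact_continuous_image continuous_intros)
  have conv: "(\<lambda>k. \<Phi> (s k) z) \<longlonglongrightarrow> \<Phi> \<xi> z"
    if "continuous_on (half_space \<times> \<Xi>) (\<lambda>(z, \<xi>). \<Phi> \<xi> z)" "z \<in> half_space"
    for \<Phi> :: "'b \<Rightarrow> real \<times> (real ^ 'n) \<Rightarrow> 'd::real_normed_vector" and z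
    using continuous_on_tendsto_compose[OF that(1) tendsto_Pair[OF tendsto_const[of z] s(2)]] that(2) \<xi> s(1)
    by simp
  note c = conv[OF C_C1c_continuous(1)[OF \<phi>]] conv[OF C_C1c_continuous(2)[OF \<phi>]]
    conv[OF C_C1c_continuous(3)[OF \<phi>]]
  have dom: "integrable lborel (\<lambda>z. B * indicator S z)" if "compact S" for S :: "'d::euclidean_space set"
    using borel_compact[OF that] emeasure_compact_finite[OF that]
    by (intro integrable_mult_right integrable_real_indicator) auto
  have "(\<lambda>k. LINT z|lborel. kernel v (\<phi> (s k)) z \<xi>) \<longlonglongrightarrow> (LINT z|lborel. kernel v (\<phi> \<xi>) z \<xi>)"
  proof (rule integral_dominated_convergence[OF _ _ dom[OF K(1)]])
    show "AE z in lborel. (\<lambda>k. kernel v (\<phi> (s k)) z \<xi>) \<longlonglongrightarrow> kernel v (\<phi> \<xi>) z \<xi>"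
    proof (intro AE_I2)
      show "(\<lambda>k. kernel v (\<phi> (s k)) z \<xi>) \<longlonglongrightarrow> kernel v (\<phi> \<xi>) z \<xi>" for z
        unfolding kernel_def
        by (cases "z \<in> half_space") (auto simp del: inner_scaleR_right intro!: tendsto_intros c(2,3))
    qed
  qed (use b1 s section_measurable(1)[OF \<phi>K K] \<xi> in auto)
  moreover have "(\<lambda>k. LINT x|lborel. init v (\<phi> (s k)) x \<xi>) \<longlonglongrightarrow> (LINT x|lborel. init v (\<phi> \<xi>) x \<xi>)"
  proof (rule integral_dominated_convergence[OF _ _ dom[OF K0]])
    show "AE x in lborel. (\<lambda>k. init v (\<phi> (s k)) x \<xi>) \<longlonglongrightarrow> init v (\<phi> \<xi>) x \<xi>"
      unfolding init_def by (intro AE_I2 tendsto_intros c(1)) auto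
  qed (use b2 s section_measurable(2)[OF \<phi>K K] \<xi> in auto)
  ultimately show ?thesis unfolding J_def by (rule tendsto_add)
qed

text \<open>
  The exceptional null set in the parametric inequality depends on the test function. It suffices
  to use the values of \<open>\<phi>\<close> on a countable dense set of parameters, because \<open>J\<close> is continuous in
  the test function.
\<close>
lemma pointwise_imp_integrated:
  assumes pt: "\<And>\<psi>. \<psi> \<in> C1c \<Longrightarrow> \<forall>z\<in>half_space. 0 \<le> \<psi> z \<Longrightarrow> AE \<xi> in \<rho>. 0 \<le> J v \<psi> \<xi>"
    and \<phi>: "\<phi> \<in> C_C1c \<Xi>" "\<forall>\<xi>\<in>\<Xi>. \<forall>z\<in>half_space. 0 \<le> \<phi> \<xi> z"
  shows "0 \<le> (LINT \<xi>|\<rho>. J v (\<phi> \<xi>) \<xi>)"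
proof -
  obtain D where D: "countable D" "D \<subseteq> \<Xi>" "\<Xi> \<subseteq> closure D"
    using separable[of \<Xi>] by blast
  have C1c: "\<phi> \<xi> \<in> C1c" if "\<xi> \<in> \<Xi>" for \<xi>
    using \<phi>(1) that unfolding C_C1c_def C1c_def by blast
  have "AE \<xi> in \<rho>. \<forall>\<xi>'\<in>D. 0 \<le> J v (\<phi> \<xi>') \<xi>"
    using D \<phi>(2) by (intro AE_ball_countable' pt C1c) auto
  then have "AE \<xi> in \<rho>. 0 \<le> J v (\<phi> \<xi>) \<xi>"
    using AE_space
  proof eventually_elim
    case (elim \<xi>)
    then have \<xi>: "\<xi> \<in> \<Xi>" by (simp add: space_\<rho>)
    then obtain s where s: "\<And>k. s k \<in> D" "s \<longlonglongrightarrow> \<xi>"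
      using D(3) by (meson closure_sequential subsetD)
    have "(\<lambda>k. J v (\<phi> (s k)) \<xi>) \<longlonglongrightarrow> J v (\<phi> \<xi>) \<xi>"
      using s D(2) by (intro J_tendsto \<phi> \<xi>) auto
    then show ?case using elim(1) s(1) by (intro LIMSEQ_le_const) blast+
  qed
  then show ?thesis by (rule integral_nonneg_AE)
qed

lemma integrated_imp_pointwise:
  assumes int: "\<And>\<phi>. \<phi> \<in> C_C1c \<Xi> \<Longrightarrow> \<forall>\<xi>\<in>\<Xi>. \<forall>z\<in>half_space. 0 \<le> \<phi> \<xi> z \<Longrightarrow> 0 \<le> (LINT \<xi>|\<rho>. J v (\<phi> \<xi>) \<xi>)"
    and \<psi>: "\<psi> \<in> C1c" "\<forall>z\<in>half_space. 0 \<le> \<psi> z"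
  shows "AE \<xi> in \<rho>. 0 \<le> J v \<psi> \<xi>"
proof -
  obtain K where K: "\<psi> \<in> C1_on K" "compact K" "K \<subseteq> half_space" using \<psi>(1) by (auto simp: C1c_def)
  show ?thesis
  proof (rule AE_nonneg_of_continuous_tests[OF \<rho> sets_\<rho> \<Xi>])
    show "integrable \<rho> (J v \<psi>)" using J_integrable[OF const_in_C_C1c[OF K]] .
    fix \<theta> :: "'b \<Rightarrow> real" assume \<theta>: "continuous_on UNIV \<theta>" "\<And>\<xi>. 0 \<le> \<theta> \<xi>"
    have "0 \<le> (LINT \<xi>|\<rho>. J v (\<lambda>z. \<theta> \<xi> * \<psi> z) \<xi>)"
      using \<theta> \<psi>(2) by (intro int scale_in_C_C1c[OF K]) (auto intro: continuous_on_subset)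
    moreover have "J v (\<lambda>z. \<theta> \<xi> * \<psi> z) \<xi> = \<theta> \<xi> * J v \<psi> \<xi>" for \<xi>
    proof -
      have "kernel v (\<lambda>z. \<theta> \<xi> * \<psi> z) z \<xi> = \<theta> \<xi> * kernel v \<psi> z \<xi>" for z
        using C1_on_scale(2,3)[OF K(1), of z] by (simp add: kernel_def indicator_def distrib_left)
      moreover have "init v (\<lambda>z. \<theta> \<xi> * \<psi> z) x \<xi> = \<theta> \<xi> * init v \<psi> x \<xi>" for x
        by (simp add: init_def)
      ultimately show ?thesis by (simp add: J_def distrib_left)
    qed
    ultimately show "0 \<le> (LINT \<xi>|\<rho>. \<theta> \<xi> * J v \<psi> \<xi>)" by simp
  qed
qed

lemma parametric_iff_weak_rep:
  "parametric_entropy_solution \<rho> (kruzhkov_family g) w\<^sub>0 (\<lambda>t x. w (t, x)) \<longleftrightarrow>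
   weak_parametric_entropy_solution_rep \<rho> (kruzhkov_family g) w\<^sub>0 (\<lambda>t x. w (t, x))"
  unfolding parametric_iff_J weak_rep_iff_J
proof safe
  fix v and \<phi> :: "'b \<Rightarrow> real \<times> (real ^ 'n) \<Rightarrow> real"
  assume "\<forall>v. \<forall>\<psi>\<in>C1c. (\<forall>z\<in>half_space. 0 \<le> \<psi> z) \<longrightarrow> (AE \<xi> in \<rho>. 0 \<le> J v \<psi> \<xi>)"
    "\<phi> \<in> C_C1c \<Xi>" "\<forall>\<xi>\<in>\<Xi>. \<forall>z\<in>half_space. 0 \<le> \<phi> \<xi> z"
  then show "0 \<le> (LINT \<xi>|\<rho>. J v (\<phi> \<xi>) \<xi>)"
    by (intro pointwise_imp_integrated) blast+
next
  fix v and \<psi> :: "real \<times> (real ^ 'n) \<Rightarrow> real"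
  assume "\<forall>v. \<forall>\<phi>\<in>C_C1c \<Xi>. (\<forall>\<xi>\<in>\<Xi>. \<forall>z\<in>half_space. 0 \<le> \<phi> \<xi> z) \<longrightarrow> 0 \<le> (LINT \<xi>|\<rho>. J v (\<phi> \<xi>) \<xi>)"
    "\<psi> \<in> C1c" "\<forall>z\<in>half_space. 0 \<le> \<psi> z"
  then show "AE \<xi> in \<rho>. 0 \<le> J v \<psi> \<xi>"
    by (intro integrated_imp_pointwise) blast+
qed

end

section \<open>The maximum principle\<close>

text \<open>
  The square of this function is a test function in the half space, supported below a smoothed
  backward cone. It
  decreases in time at least \<open>a\<close> times as fast as it varies in space. Replacing \<open>\<bar>x\<bar>\<close> by \<open>sqrt (1 + \<bar>x\<bar>\<^sup>2)\<close> smooths the axis of the cone.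
\<close>
definition cone_height :: "real \<Rightarrow> real \<Rightarrow> real \<times> (real ^ 'n) \<Rightarrow> real" where
  "cone_height a S z = max 0 (S - a * fst z - sqrt (1 + snd z \<bullet> snd z))"

text \<open>Time derivative and spatial gradient of the test function \<open>(cone_height a S z)\<^sup>2\<close>.\<close>
definition cone_dt :: "real \<Rightarrow> real \<Rightarrow> real \<times> (real ^ 'n) \<Rightarrow> real" where
  "cone_dt a S z = - (2 * a * cone_height a S z)"

definition cone_dx :: "real \<Rightarrow> real \<Rightarrow> real \<times> (real ^ 'n) \<Rightarrow> real ^ 'n" where
  "cone_dx a S z = - (2 * cone_height a S z / sqrt (1 + snd z \<bullet> snd z)) *\<^sub>R snd z"

lemma sqrt_pos: "0 < sqrt (1 + x \<bullet> x)" for x :: "real ^ 'n"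
  by (simp add: add_pos_nonneg)

text \<open>Squaring the positive part makes the test function differentiable on the boundary of the cone.\<close>
lemma max_square_deriv: "((\<lambda>y::real. (max 0 y)\<^sup>2) has_real_derivative 2 * max 0 y) (at y)"
proof -
  consider "y < 0" | "y = 0" | "0 < y" by linarith
  then show ?thesis
  proof cases
    case 1
    have "((\<lambda>y::real. 0) has_real_derivative 0) (at y)" by simp
    then have "((\<lambda>y::real. (max 0 y)\<^sup>2) has_real_derivative 0) (at y)"
      by (rule has_field_derivative_transform_within_open[where S = "{..<0}"]) (use 1 in auto)
    then show ?thesis using 1 by simp
  next
    case 2
    have "((\<lambda>h::real. max 0 h) \<longlongrightarrow> max 0 0) (at 0)" by (intro tendsto_intros)
    moreover have "\<forall>\<^sub>F h::real in at 0. max 0 h = ((max 0 (0 + h))\<^sup>2 - (max 0 0)\<^sup>2) / h"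
      by (auto simp: eventually_at_filter max_def power2_eq_square)
    ultimately have "((\<lambda>h::real. ((max 0 (0 + h))\<^sup>2 - (max 0 0)\<^sup>2) / h) \<longlongrightarrow> 0) (at 0)"
      using Lim_transform_eventually by fastforce
    then show ?thesis using 2 by (simp add: DERIV_def)
  next
    case 3
    have "((\<lambda>y::real. y\<^sup>2) has_real_derivative 2 * y) (at y)"
      by (auto intro!: derivative_eq_intros)
    then have "((\<lambda>y::real. (max 0 y)\<^sup>2) has_real_derivative 2 * y) (at y)"
      by (rule has_field_derivative_transform_within_open[where S = "{0<..}"]) (use 3 in auto)
    then show ?thesis using 3 by simp
  qed
qed

lemma cone_has_derivative:
  "((\<lambda>z. (cone_height a S z)\<^sup>2) has_derivative (\<lambda>h. cone_dt a S z * fst h + cone_dx a S z \<bullet> snd h)) (at z within A)"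
proof -
  let ?r = "\<lambda>z::real \<times> (real ^ 'n). S - a * fst z - sqrt (1 + snd z \<bullet> snd z)"
  have "(?r has_derivative (\<lambda>h. - a * fst h - (snd z \<bullet> snd h) / sqrt (1 + snd z \<bullet> snd z))) (at z within A)"
    using sqrt_pos[of "snd z"]
    by (auto intro!: derivative_eq_intros simp: inner_commute divide_simps add_pos_nonneg)
  from has_derivative_compose[OF this max_square_deriv[of "?r z", unfolded has_field_derivative_def]]
  have "((\<lambda>z. (cone_height a S z)\<^sup>2) has_derivative (\<lambda>h. 2 * cone_height a S z *
      (- a * fst h - (snd z \<bullet> snd h) / sqrt (1 + snd z \<bullet> snd z)))) (at z within A)"
    by (simp add: cone_height_def)
  then show ?thesis
    by (rule has_derivative_eq_rhs) (auto simp: cone_dt_def cone_dx_def fun_eq_iff algebra_simps)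
qed

lemma cone_continuous [continuous_intros]:
  "continuous_on A (cone_height a S)" "continuous_on A (cone_dt a S)" "continuous_on A (cone_dx a S)"
proof -
  show c: "continuous_on A (cone_height a S)" unfolding cone_height_def by (intro continuous_intros)
  show "continuous_on A (cone_dt a S)" unfolding cone_dt_def by (intro continuous_intros c)
  show "continuous_on A (cone_dx a S)"
    unfolding cone_dx_def by (intro continuous_intros c ballI less_imp_neq[OF sqrt_pos, symmetric])
qed

lemma cone_time_deriv:
  "z \<in> half_space \<Longrightarrow> time_deriv (\<lambda>z. (cone_height a S z)\<^sup>2) z = cone_dt a S z"
  using time_deriv_eq[OF cone_has_derivative] by simp

lemma cone_space_grad:
  "z \<in> half_space \<Longrightarrow> space_grad (\<lambda>z. (cone_height a S z)\<^sup>2) z = cone_dx a S z"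
  using space_grad_eq[OF cone_has_derivative] by (simp add: vec_eq_iff inner_axis)

text \<open>The support of \<open>cone_height a S\<close> in the half space is contained in this set.\<close>
definition cone_support :: "real \<Rightarrow> real \<Rightarrow> (real \<times> (real ^ 'n)) set" where
  "cone_support a S = {z \<in> half_space. 0 \<le> S - a * fst z - sqrt (1 + snd z \<bullet> snd z)}"

lemma cone_support_compact:
  assumes a: "0 < a"
  shows "compact (cone_support a S :: (real \<times> (real ^ 'n)) set)"
proof -
  have "cone_support a S \<subseteq> {0..\<bar>S\<bar> / a} \<times> (cball 0 \<bar>S\<bar> :: (real ^ 'n) set)"
  proof
    fix z :: "real \<times> (real ^ 'n)" assume z: "z \<in> cone_support a S"
    have "norm (snd z) \<le> sqrt (1 + snd z \<bullet> snd z)"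
      by (simp add: norm_eq_sqrt_inner)
    moreover have "0 \<le> a * fst z" "a * fst z + sqrt (1 + snd z \<bullet> snd z) \<le> S"
      using z a by (auto simp: cone_support_def)
    ultimately have "norm (snd z) \<le> \<bar>S\<bar>" "a * fst z \<le> \<bar>S\<bar>"
      using sqrt_pos[of "snd z"] by linarith+
    then show "z \<in> {0..\<bar>S\<bar> / a} \<times> cball 0 \<bar>S\<bar>"
      using z a by (auto simp: mem_Times_iff cone_support_def pos_le_divide_eq mult.commute)
  qed
  then have "bounded (cone_support a S :: (real \<times> (real ^ 'n)) set)"
    by (rule bounded_subset[rotated]) (intro bounded_Times bounded_closed_interval bounded_cball)
  moreover have "closed ({z. 0 \<le> S - a * fst z - sqrt (1 + snd z \<bullet> snd z)} :: (real \<times> (real ^ 'n)) set)"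
    by (intro closed_Collect_le continuous_intros)
  then have "closed (half_space \<inter> {z. 0 \<le> S - a * fst z - sqrt (1 + snd z \<bullet> snd z)} :: (real \<times> (real ^ 'n)) set)"
    by (intro closed_Int closed_Times) auto
  then have "closed (cone_support a S :: (real \<times> (real ^ 'n)) set)"
    by (simp add: cone_support_def Collect_conj_eq)
  ultimately show ?thesis by (simp add: compact_eq_bounded_closed)
qed

lemma cone_zero: "z \<in> half_space - cone_support a S \<Longrightarrow> cone_height a S z = 0"
  by (auto simp: cone_height_def cone_support_def max_def)

lemma cone_C1_on: "(\<lambda>z. (cone_height a S z)\<^sup>2) \<in> C1_on (cone_support a S)"
proof -
  have "(\<lambda>z. (cone_height a S z)\<^sup>2) differentiable_on half_space"
    using cone_has_derivative unfolding differentiable_on_def differentiable_def by blast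
  moreover have "continuous_on half_space (time_deriv (\<lambda>z. (cone_height a S z)\<^sup>2))"
    by (subst continuous_on_cong[OF refl cone_time_deriv]) (auto intro: cone_continuous)
  moreover have "continuous_on half_space (space_grad (\<lambda>z. (cone_height a S z)\<^sup>2))"
    by (subst continuous_on_cong[OF refl cone_space_grad]) (auto intro: cone_continuous)
  ultimately show ?thesis
    using cone_zero by (auto simp: C1_on_def C1_def)
qed

lemma cone_C1c: "0 < a \<Longrightarrow> (\<lambda>z. (cone_height a S z)\<^sup>2) \<in> C1c"
  using cone_C1_on cone_support_compact by (force simp: C1c_def cone_support_def)

lemma norm_cone_dx: "norm (cone_dx a S z) \<le> 2 * cone_height a S z"
proof -
  have "norm (snd z) \<le> sqrt (1 + snd z \<bullet> snd z)"
    by (simp add: norm_eq_sqrt_inner)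
  moreover have "0 \<le> cone_height a S z" by (simp add: cone_height_def)
  ultimately have "norm (snd z) / sqrt (1 + snd z \<bullet> snd z) * (2 * cone_height a S z) \<le> 1 * (2 * cone_height a S z)"
    using sqrt_pos[of "snd z"] by (intro mult_right_mono) auto
  then show ?thesis
    using sqrt_pos[of "snd z"] \<open>0 \<le> cone_height a S z\<close> by (simp add: cone_dx_def mult.commute)
qed

lemma half_space_supported_integrable:
  fixes F :: "real \<times> (real ^ 'n) \<Rightarrow> real"
  assumes a: "0 < a" and F: "F \<in> borel_measurable borel"
    and B: "\<And>z. \<bar>F z\<bar> \<le> B * indicator half_space z * cone_height a S z"
  shows "integrable lborel F"
proof (rule Bochner_Integration.integrable_bound)
  have "continuous_on (cone_support a S) (cone_height a S :: real \<times> (real ^ 'n) \<Rightarrow> real)"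
    by (rule cone_continuous)
  from borel_integrable_compact[OF cone_support_compact[OF a] this]
  show "integrable lborel (\<lambda>z :: real \<times> (real ^ 'n). B * (indicator (cone_support a S) z *\<^sub>R cone_height a S z))"
    by (intro integrable_mult_right)
  show "AE z in lborel. norm (F z) \<le> norm (B * (indicator (cone_support a S) z *\<^sub>R cone_height a S z))"
  proof (rule AE_I2)
    fix z :: "real \<times> (real ^ 'n)"
    show "norm (F z) \<le> norm (B * (indicator (cone_support a S) z *\<^sub>R cone_height a S z))"
      using B[of z] cone_zero[of z a S]
      by (cases "z \<in> cone_support a S"; cases "z \<in> half_space") (auto simp: cone_support_def)
  qed
qed (use F in simp)

lemma integral_cone_dt:
  assumes a: "0 < a"
  shows "(LINT z|lborel. indicator half_space z * cone_dt a S (z :: real \<times> (real ^ 'n))) =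
    - (LINT x|lborel. (cone_height a S (0, x :: real ^ 'n))\<^sup>2)"
proof -
  have [measurable]: "cone_dt a S \<in> borel_measurable (borel :: (real \<times> (real ^ 'n)) measure)"
    by (intro borel_measurable_continuous_onI cone_continuous)
  have int: "integrable lborel (\<lambda>z :: real \<times> (real ^ 'n). indicator half_space z * cone_dt a S z)"
  proof (rule half_space_supported_integrable[OF a, of _ "2 * a" S])
    show "(\<lambda>z. indicator half_space z * cone_dt a S z) \<in> borel_measurable (borel :: (real \<times> (real ^ 'n)) measure)"
      by measurable
  qed (use a in \<open>auto simp: cone_dt_def cone_height_def indicator_def abs_mult\<close>)
  have inner: "(LINT t|lborel. indicator half_space (t, x) * cone_dt a S (t, x)) = - (cone_height a S (0, x))\<^sup>2"
    for x :: "real ^ 'n"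
  proof -
    \<comment> \<open>The height vanishes from time \<open>T\<close> on, at every point in space.\<close>
    define T where "T = \<bar>S\<bar> / a"
    have T: "0 \<le> T" using a by (simp add: T_def)
    have z: "cone_height a S (t, x) = 0" if "T \<le> t" for t
    proof -
      have "S \<le> a * t" using that a by (simp add: T_def pos_divide_le_eq mult.commute)
      then have "S - a * t - sqrt (1 + x \<bullet> x) \<le> 0" using sqrt_pos[of x] by linarith
      then show ?thesis by (simp add: cone_height_def max_def)
    qed
    have deriv: "((\<lambda>t. (cone_height a S (t, x))\<^sup>2) has_vector_derivative cone_dt a S (t, x)) (at t within {0..T})" for t
    proof -
      have "((\<lambda>t. (t, x)) has_derivative (\<lambda>s. (s, 0))) (at t within {0..T})"
        by (auto intro!: derivative_eq_intros)
      from has_derivative_compose[OF this cone_has_derivative]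
      show ?thesis by (simp add: has_vector_derivative_def mult.commute)
    qed
    have cont: "continuous_on {0..T} (\<lambda>t. cone_dt a S (t, x))"
      by (rule continuous_on_compose2[OF cone_continuous(2)[of UNIV]]) (auto intro!: continuous_intros)
    have "(LINT t|lborel. indicator half_space (t, x) * cone_dt a S (t, x))
        = (LINT t|lborel. indicator {0..T} t *\<^sub>R cone_dt a S (t, x))"
      using z by (intro Bochner_Integration.integral_cong) (auto simp: indicator_def cone_dt_def)
    also have "\<dots> = (cone_height a S (T, x))\<^sup>2 - (cone_height a S (0, x))\<^sup>2"
      by (rule integral_FTC_atLeastAtMost[OF T deriv cont])
    finally show ?thesis using z[of T] by simp
  qed
  define F where "F z = indicator half_space z * cone_dt a S z" for z :: "real \<times> (real ^ 'n)"
  have "(LINT z|lborel. F z) = (LINT x|lborel. LINT t|lborel. F (t, x))"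
    using lborel_pair.integral_snd[of "\<lambda>t x. F (t, x)"] int
    by (simp add: lborel_prod F_def[abs_def, symmetric])
  then show ?thesis by (simp add: F_def inner)
qed

text \<open>The gradient is odd in space, so that its integral vanishes without integration by parts.\<close>
lemma integral_cone_dx:
  fixes c :: "real ^ 'n"
  assumes a: "0 < a"
  shows "(LINT z|lborel. indicator half_space z * (cone_dx a S z \<bullet> c)) = 0"
proof -
  let ?F = "\<lambda>z. indicator half_space z * (cone_dx a S z \<bullet> c)"
  have [measurable]: "cone_dx a S \<in> borel_measurable (borel :: (real \<times> (real ^ 'n)) measure)"
    by (intro borel_measurable_continuous_onI cone_continuous)
  have F[measurable]: "?F \<in> borel_measurable borel" by measurable
  have bound: "\<bar>?F z\<bar> \<le> 2 * norm c * indicator half_space z * cone_height a S z" for z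
  proof -
    have "\<bar>cone_dx a S z \<bullet> c\<bar> \<le> norm (cone_dx a S z) * norm c" by (rule Cauchy_Schwarz_ineq2)
    also have "\<dots> \<le> 2 * cone_height a S z * norm c" by (intro mult_right_mono norm_cone_dx) auto
    finally show ?thesis by (auto simp: indicator_def mult.commute mult.left_commute)
  qed
  have int: "integrable lborel ?F"
    by (rule half_space_supported_integrable[OF a F bound])
  have inner: "(LINT x|lborel. ?F (t, x)) = 0" for t
  proof -
    have "lborel = distr lborel borel (\<lambda>x :: real ^ 'n. - x)"
      using lborel_affine[of "-1" "0 :: real ^ 'n"] by (simp add: density_1)
    then have "(LINT x|lborel. ?F (t, x)) = (LINT x|distr lborel borel (\<lambda>x :: real ^ 'n. - x). ?F (t, x))"
      by simp
    also have "\<dots> = (LINT x|lborel. ?F (t, - x))"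
      by (rule integral_distr) measurable
    also have "\<dots> = (LINT x|lborel. - ?F (t, x))"
      by (intro Bochner_Integration.integral_cong) (auto simp: cone_dx_def cone_height_def indicator_def)
    finally show ?thesis by simp
  qed
  have "(LINT z|lborel. ?F z) = (LINT t|lborel. LINT x|lborel. ?F (t, x))"
    using lborel_pair.integral_fst'[of ?F] int by (simp add: lborel_prod)
  then show ?thesis by (simp only: inner) simp
qed

lemma cone_kernel_integrable:
  fixes G :: "real \<Rightarrow> real ^ 'n" and W :: "real \<times> (real ^ 'n) \<Rightarrow> real"
  assumes a: "0 < a" and G: "continuous_on UNIV G"
    and W: "W \<in> borel_measurable borel" "\<And>z. \<bar>W z\<bar> \<le> R"
  shows "integrable lborel (\<lambda>z. indicator half_space z * (cone_dt a S z * \<bar>W z - v\<bar>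
            + cone_dx a S z \<bullet> (sgn (W z - v) *\<^sub>R (G (W z) - G v))))"
proof -
  note [measurable] = W(1)
  have [measurable]: "cone_dt a S \<in> borel_measurable (borel :: (real \<times> (real ^ 'n)) measure)"
    "cone_dx a S \<in> borel_measurable (borel :: (real \<times> (real ^ 'n)) measure)"
    "G \<in> borel_measurable borel"
    by (intro borel_measurable_continuous_onI cone_continuous G)+
  have R: "0 \<le> R" using W(2)[of undefined] by linarith
  have "bounded (G ` {- max R \<bar>v\<bar>..max R \<bar>v\<bar>})"
    by (intro compact_imp_bounded compact_continuous_image continuous_on_subset[OF G]) auto
  then obtain C where C: "0 < C" "\<And>y. \<bar>y\<bar> \<le> max R \<bar>v\<bar> \<Longrightarrow> norm (G y) \<le> C"
    unfolding bounded_pos by (auto simp: abs_le_iff)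
  show ?thesis
  proof (rule half_space_supported_integrable[OF a])
    fix z :: "real \<times> (real ^ 'n)"
    have c: "0 \<le> cone_height a S z" by (simp add: cone_height_def)
    have "norm (G (W z) - G v) \<le> norm (G (W z)) + norm (G v)" by (rule norm_triangle_ineq4)
    also have "\<dots> \<le> C + C"
      using W(2)[of z] by (intro add_mono C) auto
    finally have q: "norm (sgn (W z - v) *\<^sub>R (G (W z) - G v)) \<le> 2 * C"
      using C by (auto simp: sgn_real_def)
    have "\<bar>cone_dx a S z \<bullet> (sgn (W z - v) *\<^sub>R (G (W z) - G v))\<bar> \<le> (2 * cone_height a S z) * (2 * C)"
      using c by (intro order_trans[OF Cauchy_Schwarz_ineq2 mult_mono[OF norm_cone_dx q]]) auto
    moreover have "\<bar>cone_dt a S z * \<bar>W z - v\<bar>\<bar> \<le> (2 * a * cone_height a S z) * (R + \<bar>v\<bar>)"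
      using W(2)[of z] a c unfolding cone_dt_def abs_mult abs_minus_cancel
      by (intro mult_mono) auto
    ultimately show "\<bar>indicator half_space z * (cone_dt a S z * \<bar>W z - v\<bar>
        + cone_dx a S z \<bullet> (sgn (W z - v) *\<^sub>R (G (W z) - G v)))\<bar>
      \<le> (2 * a * (R + \<bar>v\<bar>) + 4 * C) * indicator half_space z * cone_height a S z"
      by (auto simp: indicator_def algebra_simps simp del: inner_scaleR_right)
  qed measurable
qed

text \<open>
  The inequalities for the entropies \<open>\<bar>w - M\<bar>\<close> and \<open>\<bar>w + R\<bar> = w + R\<close> add up to the one for
  \<open>2 * max 0 (w - M)\<close>, whose initial term vanishes. On test functions that decrease in time faster
  than the speed of propagation \<open>L\<close> the integrand is nonpositive, hence zero.
\<close>
lemma upper_maximum_principle: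
  fixes G :: "real \<Rightarrow> real ^ 'n" and W :: "real \<times> (real ^ 'n) \<Rightarrow> real" and W\<^sub>0 :: "real ^ 'n \<Rightarrow> real"
  assumes L: "0 \<le> L" "L < a" and lip: "\<And>y. \<bar>y\<bar> \<le> R \<Longrightarrow> norm (G y - G M) \<le> L * \<bar>y - M\<bar>"
    and G: "continuous_on UNIV G"
    and W: "W \<in> borel_measurable borel" "\<And>z. \<bar>W z\<bar> \<le> R"
    and W\<^sub>0: "W\<^sub>0 \<in> borel_measurable borel" "\<And>x. - R \<le> W\<^sub>0 x" "\<And>x. W\<^sub>0 x \<le> M"
    and M: "\<bar>M\<bar> \<le> R"
    and entropy: "\<And>v. v \<in> {M, - R} \<Longrightarrow>
      0 \<le> (LINT z|lborel. indicator half_space z * (cone_dt a S z * \<bar>W z - v\<bar>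
            + cone_dx a S z \<bullet> (sgn (W z - v) *\<^sub>R (G (W z) - G v))))
          + (LINT x|lborel. (cone_height a S (0, x))\<^sup>2 * \<bar>W\<^sub>0 x - v\<bar>)"
  shows "AE z in lborel. z \<in> half_space \<longrightarrow> 0 < cone_height a S z \<longrightarrow> W z \<le> M"
proof -
  have a: "0 < a" using L by simp
  note [measurable] = W(1) W\<^sub>0(1)
  have [measurable]: "cone_dt a S \<in> borel_measurable (borel :: (real \<times> (real ^ 'n)) measure)"
    "cone_dx a S \<in> borel_measurable (borel :: (real \<times> (real ^ 'n)) measure)"
    "cone_height a S \<in> borel_measurable (borel :: (real \<times> (real ^ 'n)) measure)"
    "G \<in> borel_measurable borel"
    by (intro borel_measurable_continuous_onI cone_continuous G)+
  have c: "0 \<le> cone_height a S z" for z :: "real \<times> (real ^ 'n)" by (simp add: cone_height_def)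
  have dx: "\<bar>cone_dx a S z \<bullet> y\<bar> \<le> 2 * norm y * cone_height a S z" for z and y :: "real ^ 'n"
    using order_trans[OF Cauchy_Schwarz_ineq2[of "cone_dx a S z" y] mult_right_mono[OF norm_cone_dx norm_ge_zero]]
    by (simp add: mult.commute mult.left_commute)
  define E where "E v z = indicator half_space z * (cone_dt a S z * \<bar>W z - v\<bar>
            + cone_dx a S z \<bullet> (sgn (W z - v) *\<^sub>R (G (W z) - G v)))" for v z
  have E: "integrable lborel (E v)" for v
    unfolding E_def by (rule cone_kernel_integrable[OF a G W])
  have init: "integrable lborel (\<lambda>x. (cone_height a S (0, x))\<^sup>2 * \<bar>W\<^sub>0 x - v\<bar>)" for v
  proof (rule integrable_compact_support[where K = "snd ` cone_support a S" and B = "S\<^sup>2 * (R + \<bar>v\<bar>)"])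
    show "compact (snd ` (cone_support a S :: (real \<times> (real ^ 'n)) set))"
      by (intro compact_continuous_image continuous_intros cone_support_compact a)
    fix x :: "real ^ 'n"
    have "S - sqrt (1 + x \<bullet> x) \<le> \<bar>S\<bar>" using sqrt_pos[of x] by linarith
    then have "cone_height a S (0, x) \<le> \<bar>S\<bar>" by (simp add: cone_height_def)
    then have "(cone_height a S (0, x))\<^sup>2 \<le> S\<^sup>2"
      using power_mono[OF _ c, of "(0, x)" "\<bar>S\<bar>" 2] by simp
    moreover have "\<bar>W\<^sub>0 x - v\<bar> \<le> R + \<bar>v\<bar>" using W\<^sub>0(2,3)[of x] M by linarith
    ultimately show "norm ((cone_height a S (0, x))\<^sup>2 * \<bar>W\<^sub>0 x - v\<bar>) \<le> S\<^sup>2 * (R + \<bar>v\<bar>)"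
      by (simp add: abs_mult) (intro mult_mono; simp)
    assume "x \<notin> snd ` cone_support a S"
    then have "(0, x) \<in> half_space - cone_support a S" by force
    from cone_zero[OF this] show "(cone_height a S (0, x))\<^sup>2 * \<bar>W\<^sub>0 x - v\<bar> = 0" by simp
  qed measurable
  have dt_int: "integrable lborel (\<lambda>z :: real \<times> (real ^ 'n). indicator half_space z * cone_dt a S z)"
  proof (rule half_space_supported_integrable[OF a, of _ "2 * a" S])
    show "(\<lambda>z. indicator half_space z * cone_dt a S z) \<in> borel_measurable (borel :: (real \<times> (real ^ 'n)) measure)"
      by measurable
  qed (use a in \<open>auto simp: cone_dt_def cone_height_def indicator_def abs_mult\<close>)
  define d where "d = G M - G (- R)"
  have dx_int: "integrable lborel (\<lambda>z. indicator half_space z * (cone_dx a S z \<bullet> d))"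
  proof (rule half_space_supported_integrable[OF a, of _ "2 * norm d" S])
    show "(\<lambda>z. indicator half_space z * (cone_dx a S z \<bullet> d)) \<in> borel_measurable borel" by measurable
  qed (use dx[of _ d] in \<open>auto simp: indicator_def\<close>)
  \<comment> \<open>Subtracting the two entropy integrands from the parts whose integrals are known leaves \<open>-2\<close>
    times the integrand for the positive part of \<open>W - M\<close>.\<close>
  define P where "P z = (M + R) * (indicator half_space z * cone_dt a S z)
      + indicator half_space z * (cone_dx a S z \<bullet> d) - E M z - E (- R) z" for z
  have ER: "integrable lborel (E M)" "integrable lborel (E (- R))" by (rule E)+
  have P_int: "integrable lborel P"
    unfolding P_def by (intro Bochner_Integration.integrable_diff Bochner_Integration.integrable_add
      integrable_mult_right dt_int dx_int ER)
  have dt_val: "(LINT z|lborel. indicator half_space z * cone_dt a S (z :: real \<times> (real ^ 'n))) =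
      - (LINT x|lborel. (cone_height a S (0, x :: real ^ 'n))\<^sup>2)"
    by (rule integral_cone_dt[OF a])
  have "(LINT z|lborel. P z) = - ((M + R) * (LINT x|lborel. (cone_height a S (0, x :: real ^ 'n))\<^sup>2))
      - (LINT z|lborel. E M z) - (LINT z|lborel. E (- R) z)"
    unfolding P_def using dt_int dx_int ER dt_val integral_cone_dx[OF a, of S d]
    by (simp add: algebra_simps)
  moreover have "(M + R) * (LINT x|lborel. (cone_height a S (0, x :: real ^ 'n))\<^sup>2) =
      (LINT x|lborel. (cone_height a S (0, x))\<^sup>2 * \<bar>W\<^sub>0 x - M\<bar>)
      + (LINT x|lborel. (cone_height a S (0, x))\<^sup>2 * \<bar>W\<^sub>0 x - (- R)\<bar>)"
    unfolding Bochner_Integration.integral_add[OF init init, symmetric] integral_mult_right_zero[symmetric]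
  proof (intro Bochner_Integration.integral_cong refl)
    fix x
    have "M + R = \<bar>W\<^sub>0 x - M\<bar> + \<bar>W\<^sub>0 x - (- R)\<bar>" using W\<^sub>0(2,3)[of x] by linarith
    from arg_cong[OF this, of "\<lambda>y. (cone_height a S (0, x))\<^sup>2 * y"]
    show "(M + R) * (cone_height a S (0, x))\<^sup>2 = (cone_height a S (0, x))\<^sup>2 * \<bar>W\<^sub>0 x - M\<bar>
        + (cone_height a S (0, x))\<^sup>2 * \<bar>W\<^sub>0 x - (- R)\<bar>"
      by (simp only: mult.commute[of "M + R"] distrib_left)
  qed
  moreover have "0 \<le> (LINT z|lborel. E v z) + (LINT x|lborel. (cone_height a S (0, x))\<^sup>2 * \<bar>W\<^sub>0 x - v\<bar>)"
    if "v \<in> {M, - R}" for v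
    using entropy[OF that] unfolding E_def .
  from this[of M] this[of "- R"]
  have "0 \<le> (LINT z|lborel. E M z) + (LINT x|lborel. (cone_height a S (0, x))\<^sup>2 * \<bar>W\<^sub>0 x - M\<bar>)"
    "0 \<le> (LINT z|lborel. E (- R) z) + (LINT x|lborel. (cone_height a S (0, x))\<^sup>2 * \<bar>W\<^sub>0 x - (- R)\<bar>)"
    by auto
  ultimately have P_le: "(LINT z|lborel. P z) \<le> 0" by linarith
  have P_ge: "4 * (a - L) * cone_height a S z * max 0 (W z - M) \<le> P z" if z: "z \<in> half_space" for z
  proof -
    have "0 \<le> W z + R" using W(2)[of z] by linarith
    then have R_term: "sgn (W z - (- R)) *\<^sub>R (G (W z) - G (- R)) = G (W z) - G (- R)" "\<bar>W z - (- R)\<bar> = W z + R"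
      by (cases "W z = - R"; simp add: sgn_real_def)+
    have ER_eq: "E (- R) z = cone_dt a S z * (W z + R) + cone_dx a S z \<bullet> (G (W z) - G (- R))"
      unfolding E_def R_term using z by simp
    show ?thesis
    proof (cases "M < W z")
      case True
      have "P z = - 2 * (cone_dt a S z * (W z - M) + cone_dx a S z \<bullet> (G (W z) - G M))"
        unfolding P_def ER_eq using True z by (simp add: E_def d_def algebra_simps inner_diff_right)
      moreover have "\<bar>cone_dx a S z \<bullet> (G (W z) - G M)\<bar> \<le> 2 * (L * (W z - M)) * cone_height a S z"
        using dx[of z "G (W z) - G M"] mult_right_mono[OF mult_left_mono[OF lip[OF W(2)[of z]], of 2] c[of z]] True
        by simp
      ultimately show ?thesis using True by (simp add: cone_dt_def algebra_simps)
    next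
      case False
      have "sgn (W z - M) *\<^sub>R (G (W z) - G M) = G M - G (W z)"
        using False by (cases "W z = M") auto
      then have "E M z = cone_dt a S z * (M - W z) + cone_dx a S z \<bullet> (G M - G (W z))"
        using False z by (simp add: E_def del: inner_scaleR_right)
      then have "P z = 0"
        unfolding P_def ER_eq using z by (simp add: d_def algebra_simps inner_diff_right)
      then show ?thesis using False by simp
    qed
  qed
  have P_nonneg: "0 \<le> P z" for z
  proof (cases "z \<in> half_space")
    case True
    have "0 \<le> 4 * (a - L) * cone_height a S z * max 0 (W z - M)" using L c[of z] by simp
    then show ?thesis using P_ge[OF True] by linarith
  qed (simp add: P_def E_def)
  have "(LINT z|lborel. P z) = 0"
    using P_le Bochner_Integration.integral_nonneg[of lborel P] P_nonneg by (simp add: order_antisym)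
  then have "AE z in lborel. P z = 0"
    using P_nonneg P_int by (subst (asm) integral_nonneg_eq_0_iff_AE) auto
  then show ?thesis
  proof eventually_elim
    case (elim z)
    show ?case
    proof (intro impI)
      assume "z \<in> half_space" "0 < cone_height a S z"
      then have "max 0 (W z - M) \<le> 0"
        using P_ge[of z] elim L by (simp add: mult_le_0_iff)
      then show "W z \<le> M" by simp
    qed
  qed
qed

lemma C1_lipschitz_on_interval:
  fixes G :: "real \<Rightarrow> 'c::euclidean_space"
  assumes G: "G C1_differentiable_on UNIV"
  obtains L where "0 \<le> L" "\<And>x y. \<bar>x\<bar> \<le> R \<Longrightarrow> \<bar>y\<bar> \<le> R \<Longrightarrow> norm (G x - G y) \<le> L * \<bar>x - y\<bar>"
proof -
  obtain D where D: "\<And>x. (G has_vector_derivative D x) (at x)" and contD: "continuous_on UNIV D"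
    using G unfolding C1_differentiable_on_def by auto
  have "bounded (D ` {- R..R})"
    by (intro compact_imp_bounded compact_continuous_image continuous_on_subset[OF contD]) auto
  then obtain L where L: "0 < L" "\<And>x. x \<in> {- R..R} \<Longrightarrow> norm (D x) \<le> L"
    unfolding bounded_pos by auto
  have "norm (G x - G y) \<le> L * norm (x - y)" if "x \<in> {- R..R}" "y \<in> {- R..R}" for x y
  proof (rule differentiable_bound[of "{- R..R}" G "\<lambda>x h. h *\<^sub>R D x"])
    show "(G has_derivative (\<lambda>h. h *\<^sub>R D x)) (at x within {- R..R})" for x
      using D[of x] unfolding has_vector_derivative_def by (rule has_derivative_at_withinI)
    show "onorm (\<lambda>h. h *\<^sub>R D x) \<le> L" if "x \<in> {- R..R}" for x
    proof (rule onorm_bound)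
      show "norm (h *\<^sub>R D x) \<le> L * norm h" for h
        using mult_right_mono[OF L(2)[OF that], of "\<bar>h\<bar>"] by (simp add: mult.commute)
    qed (use L in simp)
  qed (use that in auto)
  then show thesis using L(1) by (intro that[of L]) (auto simp: abs_le_iff)
qed

lemma parametric_kruzhkov_iff:
  "parametric_entropy_solution \<rho> (kruzhkov_family g) u\<^sub>0 u \<longleftrightarrow>
    (AE \<xi> in \<rho>. (\<lambda>(t, x). u t x \<xi>) \<in> Linf (lebesgue_on half_space)) \<and>
    (\<forall>v. \<forall>\<psi>\<in>C1c. (\<forall>z\<in>half_space. 0 \<le> \<psi> z) \<longrightarrow> (AE \<xi> in \<rho>. 0 \<le>
      (LINT t|lebesgue_on {0..}. LINT x|lebesgue. time_deriv \<psi> (t, x) * \<bar>u t x \<xi> - v\<bar>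
        + space_grad \<psi> (t, x) \<bullet> (sgn (u t x \<xi> - v) *\<^sub>R (g (u t x \<xi>) \<xi> - g v \<xi>)))
      + (LINT x|lebesgue. \<psi> (0, x) * \<bar>u\<^sub>0 x \<xi> - v\<bar>)))"
  unfolding parametric_entropy_solution_def kruzhkov_family_def by (simp del: inner_scaleR_right)

text \<open>The interior term of the Kruzhkov inequality for the cone test functions as one integral.\<close>
lemma iterated_eq_cone_kernel:
  fixes G :: "real \<Rightarrow> real ^ 'n" and W :: "real \<times> (real ^ 'n) \<Rightarrow> real"
  assumes a: "0 < a" and G: "continuous_on UNIV G"
    and W: "W \<in> borel_measurable borel" "\<And>z. \<bar>W z\<bar> \<le> R"
    and w: "AE z in lebesgue_on half_space. w z = W z"
  shows "(LINT t|lebesgue_on {0..}. LINT x|lebesgue.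
        time_deriv (\<lambda>z. (cone_height a S z)\<^sup>2) (t, x) * \<bar>w (t, x) - v\<bar>
        + space_grad (\<lambda>z. (cone_height a S z)\<^sup>2) (t, x) \<bullet> (sgn (w (t, x) - v) *\<^sub>R (G (w (t, x)) - G v)))
    = (LINT z|lborel. indicator half_space z * (cone_dt a S z * \<bar>W z - v\<bar>
        + cone_dx a S z \<bullet> (sgn (W z - v) *\<^sub>R (G (W z) - G v))))" (is "?L = (LINT z|lborel. ?E z)")
proof -
  interpret T: complete_measure "lebesgue_on {0 :: real ..}"
    by (rule complete_measure_lebesgue_on) simp
  have "?L = (LINT t|lebesgue_on {0..}. LINT x|lebesgue. ?E (t, x))"
  proof (rule T.integral_AE_eq)
    show "AE t in lebesgue_on {0..}. (LINT x|lebesgue.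
        time_deriv (\<lambda>z. (cone_height a S z)\<^sup>2) (t, x) * \<bar>w (t, x) - v\<bar>
        + space_grad (\<lambda>z. (cone_height a S z)\<^sup>2) (t, x) \<bullet> (sgn (w (t, x) - v) *\<^sub>R (G (w (t, x)) - G v)))
      = (LINT x|lebesgue. ?E (t, x))"
      using AE_half_space_split[OF w] AE_space
    proof eventually_elim
      case (elim t)
      then have t: "(t, x) \<in> half_space" for x :: "real ^ 'n" by simp
      show ?case
      proof (rule completion.integral_AE_eq, use elim(1) in eventually_elim)
        case (elim x)
        then show ?case using cone_time_deriv[OF t] cone_space_grad[OF t] t[of x] by simp
      qed
    qed
  qed
  also have "\<dots> = (LINT z|lborel. ?E z)"
    by (intro integral_half_space_iterated cone_kernel_integrable[OF a G W]) simp
  finally show ?thesis .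
qed

text \<open>
  Slopes, heights and truncation levels run through the natural numbers, so that countably many
  entropies and test functions suffice at almost every parameter. The lower bound is the upper one
  for \<open>- w\<close> and the flux \<open>\<lambda>y. - g (- y)\<close>.
\<close>
lemma parametric_entropy_solution_bound:
  fixes g :: "real \<Rightarrow> 'b \<Rightarrow> real ^ 'n" and w :: "real \<times> (real ^ 'n) \<Rightarrow> 'b \<Rightarrow> real"
  assumes sol: "parametric_entropy_solution \<rho> (kruzhkov_family g) w\<^sub>0 (\<lambda>t x. w (t, x))"
    and g: "\<And>\<xi>. (\<lambda>y. g y \<xi>) C1_differentiable_on UNIV"
    and w: "\<And>\<xi>. \<xi> \<in> space \<rho> \<Longrightarrow> (\<lambda>z. w z \<xi>) \<in> borel_measurable borel"
    and w\<^sub>0: "\<And>\<xi>. \<xi> \<in> space \<rho> \<Longrightarrow> (\<lambda>x. w\<^sub>0 x \<xi>) \<in> borel_measurable borel" "\<And>x \<xi>. \<bar>w\<^sub>0 x \<xi>\<bar> \<le> M"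
  shows "AE \<xi> in \<rho>. AE z in lebesgue_on half_space. \<bar>w z \<xi>\<bar> \<le> M"
proof -
  let ?\<psi> = "\<lambda>(a::nat) (S::nat) z. (cone_height (real (Suc a)) (real S) z)\<^sup>2 :: real"
  let ?I = "\<lambda>v \<psi> \<xi>. (LINT t|lebesgue_on {0..}. LINT x|lebesgue. time_deriv \<psi> (t, x) * \<bar>w (t, x) \<xi> - v\<bar>
        + space_grad \<psi> (t, x) \<bullet> (sgn (w (t, x) \<xi> - v) *\<^sub>R (g (w (t, x) \<xi>) \<xi> - g v \<xi>)))
      + (LINT x|lebesgue. \<psi> (0, x) * \<bar>w\<^sub>0 x \<xi> - v\<bar>)"
  have "AE \<xi> in \<rho>. 0 \<le> ?I v (?\<psi> a S) \<xi>" for v a S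
    using sol[unfolded parametric_kruzhkov_iff, THEN conjunct2, rule_format, OF cone_C1c[of "real (Suc a)" "real S"]]
    by (simp del: inner_scaleR_right of_nat_Suc)
  then have ineq: "AE \<xi> in \<rho>. \<forall>R a S. \<forall>v\<in>{M, - M, real R, - real R}. 0 \<le> ?I v (?\<psi> a S) \<xi>"
    unfolding AE_all_countable by (intro allI AE_finite_allI) auto
  have linf: "AE \<xi> in \<rho>. (\<lambda>(t, x). w (t, x) \<xi>) \<in> Linf (lebesgue_on half_space)"
    using sol by (simp add: parametric_entropy_solution_def)
  show ?thesis
    using ineq linf AE_space
  proof eventually_elim
    case (elim \<xi>)
    have "(\<lambda>(t, x). w (t, x) \<xi>) = (\<lambda>z. w z \<xi>)" by (simp add: fun_eq_iff)
    then obtain C where C: "AE z in lebesgue_on half_space. \<bar>w z \<xi>\<bar> \<le> C"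
      using elim(2) by (auto simp: Linf_def)
    \<comment> \<open>At this parameter the state is bounded by some \<open>R\<close>, which also gives a Lipschitz constant of
      the flux, the speed of propagation.\<close>
    obtain R :: nat where R: "max C M \<le> real R" using real_arch_simple by blast
    define W where "W z = max (- real R) (min (real R) (w z \<xi>))" for z
    define G where "G y = g y \<xi>" for y
    have G: "continuous_on UNIV G"
      unfolding G_def by (rule C1_differentiable_imp_continuous_on[OF g])
    obtain L0 where L0: "0 \<le> L0" "\<And>x y. \<bar>x\<bar> \<le> real R \<Longrightarrow> \<bar>y\<bar> \<le> real R \<Longrightarrow> norm (G x - G y) \<le> L0 * \<bar>x - y\<bar>"
      using C1_lipschitz_on_interval[OF g[of \<xi>], of "real R"] unfolding G_def by metis
    obtain L :: nat where L: "L0 \<le> real L" using real_arch_simple by blast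
    have lip: "norm (G x - G y) \<le> real L * \<bar>x - y\<bar>" if "\<bar>x\<bar> \<le> real R" "\<bar>y\<bar> \<le> real R" for x y
      using L0(2)[OF that] mult_right_mono[OF L, of "\<bar>x - y\<bar>"] by simp
    have W: "W \<in> borel_measurable borel" "\<bar>W z\<bar> \<le> real R" for z
      using w[OF elim(3)] unfolding W_def by (auto simp: abs_le_iff)
    have wW: "AE z in lebesgue_on half_space. w z \<xi> = W z"
      using C by eventually_elim (use R in \<open>auto simp: W_def\<close>)
    have w0: "(\<lambda>x. w\<^sub>0 x \<xi>) \<in> borel_measurable borel" by (rule w\<^sub>0(1)[OF elim(3)])
    let ?a = "real (Suc L)"
    have ent: "0 \<le> (LINT z|lborel. indicator half_space z * (cone_dt ?a (real S) z * \<bar>W z - v\<bar>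
            + cone_dx ?a (real S) z \<bullet> (sgn (W z - v) *\<^sub>R (G (W z) - G v))))
          + (LINT x|lborel. (cone_height ?a (real S) (0, x))\<^sup>2 * \<bar>w\<^sub>0 x \<xi> - v\<bar>)"
      if v: "v \<in> {M, - M, real R, - real R}" for v and S :: nat
    proof -
      have [measurable]: "cone_height ?a (real S) \<in> borel_measurable (borel :: (real \<times> (real ^ 'n)) measure)"
        by (intro borel_measurable_continuous_onI cone_continuous)
      note [measurable] = w0
      have "(LINT x|lebesgue. (cone_height ?a (real S) (0, x))\<^sup>2 * \<bar>w\<^sub>0 x \<xi> - v\<bar>) =
          (LINT x|lborel. (cone_height ?a (real S) (0, x))\<^sup>2 * \<bar>w\<^sub>0 x \<xi> - v\<bar>)"
        by (rule integral_completion) measurable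
      moreover have a: "0 < ?a" by simp
      have "0 \<le> ?I v (?\<psi> L S) \<xi>" using elim(1) v by blast
      ultimately show ?thesis
        unfolding iterated_eq_cone_kernel[OF a G W wW, of "real S" v, unfolded G_def]
        unfolding G_def by (simp only:)
    qed
    have M: "\<bar>M\<bar> \<le> real R" using w\<^sub>0(2)[of undefined \<xi>] R by auto
    have upper: "AE z in lborel. z \<in> half_space \<longrightarrow> 0 < cone_height ?a (real S) z \<longrightarrow> W z \<le> M" for S :: nat
    proof (rule upper_maximum_principle[where L = "real L" and R = "real R" and G = G and W\<^sub>0 = "\<lambda>x. w\<^sub>0 x \<xi>"])
      show "- real R \<le> w\<^sub>0 x \<xi>" "w\<^sub>0 x \<xi> \<le> M" for x using w\<^sub>0(2)[of x \<xi>] R by auto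
      show "norm (G y - G M) \<le> real L * \<bar>y - M\<bar>" if "\<bar>y\<bar> \<le> real R" for y by (rule lip[OF that M])
    qed (use W w0 M G ent in auto)
    have lower: "AE z in lborel. z \<in> half_space \<longrightarrow> 0 < cone_height ?a (real S) z \<longrightarrow> - W z \<le> M" for S :: nat
    proof (rule upper_maximum_principle[where L = "real L" and R = "real R" and G = "\<lambda>y. - G (- y)"
          and W = "\<lambda>z. - W z" and W\<^sub>0 = "\<lambda>x. - w\<^sub>0 x \<xi>"])
      show "- real R \<le> - w\<^sub>0 x \<xi>" "- w\<^sub>0 x \<xi> \<le> M" for x using w\<^sub>0(2)[of x \<xi>] R by auto
      show "norm (- G (- y) - - G (- M)) \<le> real L * \<bar>y - M\<bar>" if "\<bar>y\<bar> \<le> real R" for y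
        using lip[of "- M" "- y"] that M by (simp add: norm_minus_commute)
      show "continuous_on UNIV (\<lambda>y. - G (- y))"
        by (intro continuous_intros continuous_on_compose2[OF G]) auto
      fix v assume "v \<in> {M, - real R}"
      then have "- v \<in> {M, - M, real R, - real R}" by auto
      moreover have "\<bar>- W z - v\<bar> = \<bar>W z - (- v)\<bar>" "\<bar>- w\<^sub>0 x \<xi> - v\<bar> = \<bar>w\<^sub>0 x \<xi> - (- v)\<bar>"
        "sgn (- W z - v) *\<^sub>R (- G (- (- W z)) - - G (- v)) = sgn (W z - (- v)) *\<^sub>R (G (W z) - G (- v))" for z x
        by (auto simp: sgn_real_def algebra_simps)
      ultimately show "0 \<le> (LINT z|lborel. indicator half_space z * (cone_dt ?a (real S) z * \<bar>- W z - v\<bar>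
            + cone_dx ?a (real S) z \<bullet> (sgn (- W z - v) *\<^sub>R (- G (- (- W z)) - - G (- v)))))
          + (LINT x|lborel. (cone_height ?a (real S) (0, x))\<^sup>2 * \<bar>- w\<^sub>0 x \<xi> - v\<bar>)"
        using ent[of "- v" S] by (simp only:)
    qed (use W w0 M in auto)
    have "AE z in lborel. \<forall>S::nat. z \<in> half_space \<longrightarrow> 0 < cone_height ?a (real S) z \<longrightarrow> \<bar>W z\<bar> \<le> M"
      unfolding AE_all_countable
    proof
      fix S :: nat
      show "AE z in lborel. z \<in> half_space \<longrightarrow> 0 < cone_height ?a (real S) z \<longrightarrow> \<bar>W z\<bar> \<le> M"
        using upper[of S] lower[of S] by eventually_elim (simp add: abs_le_iff)
    qed
    then have "AE z in lborel. z \<in> half_space \<longrightarrow> \<bar>W z\<bar> \<le> M"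
    proof eventually_elim
      case (elim z)
      obtain S :: nat where "?a * fst z + sqrt (1 + snd z \<bullet> snd z) < real S"
        using reals_Archimedean2 by blast
      then have "0 < cone_height ?a (real S) z" by (simp add: cone_height_def)
      then show ?case using elim by blast
    qed
    then have "AE z in lebesgue_on half_space. \<bar>W z\<bar> \<le> M"
      using half_space_lebesgue by (subst AE_restrict_space_iff) (auto simp: AE_completion_iff)
    then show ?case using wW by eventually_elim simp
  qed
qed

section \<open>Passing to versions\<close>

lemma is_version_sym:
  assumes "is_version \<rho> M U V"
  shows "is_version \<rho> M V U"
  using assms unfolding is_version_def
proof eventually_elim
  case (elim \<xi>)
  then show ?case by eventually_elim simp
qed

lemma is_version_trans:
  assumes "is_version \<rho> M U V" "is_version \<rho> M V W"
  shows "is_version \<rho> M U W"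
  using assms unfolding is_version_def
proof eventually_elim
  case (elim \<xi>)
  then show ?case by eventually_elim simp
qed

lemma parametric_entropy_solution_version:
  fixes f g :: "real \<Rightarrow> 'b \<Rightarrow> real ^ 'n"
  assumes sol: "parametric_entropy_solution \<rho> (kruzhkov_family f) u\<^sub>0 u"
    and fg: "AE \<xi> in \<rho>. \<forall>y. g y \<xi> = f y \<xi>"
    and u: "is_version \<rho> (lebesgue_on half_space) (\<lambda>\<xi> (t, x). u t x \<xi>) (\<lambda>\<xi> (t, x). u' t x \<xi>)"
    and u0: "is_version \<rho> lebesgue (\<lambda>\<xi> x. u\<^sub>0 x \<xi>) (\<lambda>\<xi> x. u\<^sub>0' x \<xi>)"
  shows "parametric_entropy_solution \<rho> (kruzhkov_family g) u\<^sub>0' u'"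
proof -
  interpret H: complete_measure "lebesgue_on half_space :: (real \<times> (real ^ 'n)) measure"
    by (rule complete_measure_lebesgue_on[OF half_space_lebesgue])
  interpret T: complete_measure "lebesgue_on {0 :: real ..}"
    by (rule complete_measure_lebesgue_on) simp
  have "AE \<xi> in \<rho>. (\<lambda>(t, x). u t x \<xi>) \<in> Linf (lebesgue_on half_space)"
    using sol by (simp add: parametric_entropy_solution_def)
  then have "AE \<xi> in \<rho>. (\<lambda>(t, x). u' t x \<xi>) \<in> Linf (lebesgue_on half_space)"
    using u unfolding is_version_def
  proof eventually_elim
    case (elim \<xi>)
    have eq: "AE z in lebesgue_on half_space. (\<lambda>(t, x). u t x \<xi>) z = (\<lambda>(t, x). u' t x \<xi>) z"
      using elim(2) by eventually_elim simp
    obtain C where C: "AE z in lebesgue_on half_space. \<bar>(\<lambda>(t, x). u t x \<xi>) z\<bar> \<le> C"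
      using elim(1) by (auto simp: Linf_def)
    have "AE z in lebesgue_on half_space. \<bar>(\<lambda>(t, x). u' t x \<xi>) z\<bar> \<le> C"
      using C eq by eventually_elim simp
    then show ?case
      using H.measurable_AE_eq[OF eq] elim(1) by (auto simp: Linf_def)
  qed
  moreover have "AE \<xi> in \<rho>.
     (LINT t|lebesgue_on {0..}. LINT x|lebesgue. time_deriv \<psi> (t, x) * \<bar>u' t x \<xi> - v\<bar>
        + space_grad \<psi> (t, x) \<bullet> (sgn (u' t x \<xi> - v) *\<^sub>R (g (u' t x \<xi>) \<xi> - g v \<xi>)))
      + (LINT x|lebesgue. \<psi> (0, x) * \<bar>u\<^sub>0' x \<xi> - v\<bar>) \<ge> 0"
    if \<psi>: "\<psi> \<in> C1c" "\<forall>z\<in>half_space. 0 \<le> \<psi> z" for \<psi> v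
  proof -
    have "AE \<xi> in \<rho>.
     (LINT t|lebesgue_on {0..}. LINT x|lebesgue. time_deriv \<psi> (t, x) * \<bar>u t x \<xi> - v\<bar>
        + space_grad \<psi> (t, x) \<bullet> (sgn (u t x \<xi> - v) *\<^sub>R (f (u t x \<xi>) \<xi> - f v \<xi>)))
      + (LINT x|lebesgue. \<psi> (0, x) * \<bar>u\<^sub>0 x \<xi> - v\<bar>) \<ge> 0"
      using sol \<psi> unfolding parametric_kruzhkov_iff by blast
    then show ?thesis
      using fg u u0 unfolding is_version_def
    proof eventually_elim
      case (elim \<xi>)
      have uu: "AE t in lebesgue_on {0..}. AE x in lebesgue. u' t x \<xi> = u t x \<xi>"
        using AE_half_space_split[OF elim(3)] by simp
      have "(LINT t|lebesgue_on {0..}. LINT x|lebesgue. time_deriv \<psi> (t, x) * \<bar>u' t x \<xi> - v\<bar>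
          + space_grad \<psi> (t, x) \<bullet> (sgn (u' t x \<xi> - v) *\<^sub>R (g (u' t x \<xi>) \<xi> - g v \<xi>)))
        = (LINT t|lebesgue_on {0..}. LINT x|lebesgue. time_deriv \<psi> (t, x) * \<bar>u t x \<xi> - v\<bar>
          + space_grad \<psi> (t, x) \<bullet> (sgn (u t x \<xi> - v) *\<^sub>R (f (u t x \<xi>) \<xi> - f v \<xi>)))"
      proof (rule T.integral_AE_eq, use uu in eventually_elim)
        case t: (elim t)
        show ?case
          by (rule completion.integral_AE_eq, use t in eventually_elim) (simp add: elim(2))
      qed
      moreover have "(LINT x|lebesgue. \<psi> (0, x) * \<bar>u\<^sub>0' x \<xi> - v\<bar>) = (LINT x|lebesgue. \<psi> (0, x) * \<bar>u\<^sub>0 x \<xi> - v\<bar>)"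
        by (rule completion.integral_AE_eq, use elim(4) in eventually_elim) simp
      ultimately show ?case using elim(1) by (simp only:)
    qed
  qed
  ultimately show ?thesis
    unfolding parametric_kruzhkov_iff by blast
qed

lemma weak_parametric_entropy_solution_version:
  fixes f g :: "real \<Rightarrow> 'b::topological_space \<Rightarrow> real ^ 'n"
  assumes sol: "weak_parametric_entropy_solution \<rho> (kruzhkov_family f) u\<^sub>0 u"
    and fg: "AE \<xi> in \<rho>. \<forall>y. g y \<xi> = f y \<xi>"
    and u: "is_version \<rho> (lebesgue_on half_space) (\<lambda>\<xi> (t, x). u t x \<xi>) (\<lambda>\<xi> (t, x). u' t x \<xi>)"
    and u0: "is_version \<rho> lebesgue (\<lambda>\<xi> x. u\<^sub>0 x \<xi>) (\<lambda>\<xi> x. u\<^sub>0' x \<xi>)"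
  shows "weak_parametric_entropy_solution \<rho> (kruzhkov_family g) u\<^sub>0' u'"
proof -
  obtain w w0 where
    w: "is_version \<rho> (lebesgue_on half_space) (\<lambda>\<xi> (t, x). u t x \<xi>) (\<lambda>\<xi> (t, x). w t x \<xi>)"
    and w0: "is_version \<rho> lebesgue (\<lambda>\<xi> x. u\<^sub>0 x \<xi>) (\<lambda>\<xi> x. w0 x \<xi>)"
    and w0m: "(\<lambda>(x, \<xi>). w0 x \<xi>) \<in> borel_measurable (completion (lebesgue \<Otimes>\<^sub>M \<rho>))"
    and rep: "weak_parametric_entropy_solution_rep \<rho> (kruzhkov_family f) w0 w"
    using sol unfolding weak_parametric_entropy_solution_def by blast
  have ae: "AE \<xi> in completion \<rho>. \<forall>y. g y \<xi> = f y \<xi>"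
    using fg by (simp add: AE_completion_iff)
  have "(LINT \<xi>|completion \<rho>. time_deriv (\<phi> \<xi>) (t, x) * \<bar>w t x \<xi> - v\<bar>
        + space_grad (\<phi> \<xi>) (t, x) \<bullet> (sgn (w t x \<xi> - v) *\<^sub>R (g (w t x \<xi>) \<xi> - g v \<xi>)))
    = (LINT \<xi>|completion \<rho>. time_deriv (\<phi> \<xi>) (t, x) * \<bar>w t x \<xi> - v\<bar>
        + space_grad (\<phi> \<xi>) (t, x) \<bullet> (sgn (w t x \<xi> - v) *\<^sub>R (f (w t x \<xi>) \<xi> - f v \<xi>)))" for \<phi> t x v
    by (rule completion.integral_AE_eq, use ae in eventually_elim) simp
  then have "weak_parametric_entropy_solution_rep \<rho> (kruzhkov_family g) w0 w"
    using rep unfolding weak_parametric_entropy_solution_rep_def kruzhkov_family_def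
    by (simp del: inner_scaleR_right)
  moreover have "is_version \<rho> (lebesgue_on half_space) (\<lambda>\<xi> (t, x). u' t x \<xi>) (\<lambda>\<xi> (t, x). w t x \<xi>)"
    by (rule is_version_trans[OF is_version_sym[OF u] w])
  moreover have "is_version \<rho> lebesgue (\<lambda>\<xi> x. u\<^sub>0' x \<xi>) (\<lambda>\<xi> x. w0 x \<xi>)"
    by (rule is_version_trans[OF is_version_sym[OF u0] w0])
  ultimately show ?thesis
    unfolding weak_parametric_entropy_solution_def using w0m by blast
qed

section \<open>Equivalence of the two notions\<close>

text \<open>A weak-parametric solution is bounded by definition, uniformly in the parameter.\<close>
lemma weak_rep_bound:
  fixes w :: "real \<times> (real ^ 'n) \<Rightarrow> 'b::topological_space \<Rightarrow> real"
  assumes "prob_space \<rho>" and rep: "weak_parametric_entropy_solution_rep \<rho> E w\<^sub>0 (\<lambda>t x. w (t, x))"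
  obtains C where "AE \<xi> in \<rho>. AE z in lebesgue_on half_space. \<bar>w z \<xi>\<bar> \<le> C"
proof -
  interpret \<rho>: prob_space \<rho> by fact
  interpret LH: sigma_finite_measure "lebesgue_on half_space :: (real \<times> (real ^ 'n)) measure"
    using half_space_lebesgue
    by (intro sigma_finite_measure_restrict_space sigma_finite_completion lborel.sigma_finite_measure_axioms)
  interpret PH: pair_sigma_finite "lebesgue_on half_space :: (real \<times> (real ^ 'n)) measure" \<rho> ..
  have "(\<lambda>((t, x), \<xi>). w (t, x) \<xi>) \<in> Linf (completion (lebesgue_on half_space \<Otimes>\<^sub>M \<rho>))"
    using rep by (simp add: weak_parametric_entropy_solution_rep_def)
  then obtain C where "AE p in lebesgue_on half_space \<Otimes>\<^sub>M \<rho>. \<bar>(\<lambda>((t, x), \<xi>). w (t, x) \<xi>) p\<bar> \<le> C"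
    by (auto simp: Linf_def AE_completion_iff)
  from PH.AE_pair_swap[OF this] show thesis
    by (intro that[of C]) (simp add: case_prod_beta)
qed

theorem theorem2p11:
  fixes \<Xi> :: "(real ^ 'p) set"
    and \<rho> :: "(real ^ 'p) measure"
    and f :: "real \<Rightarrow> real ^ 'p \<Rightarrow> real ^ 'n"
    and u\<^sub>0 :: "real ^ 'n \<Rightarrow> real ^ 'p \<Rightarrow> real"
    and u :: "real \<Rightarrow> real ^ 'n \<Rightarrow> real ^ 'p \<Rightarrow> real"
  assumes "compact \<Xi>"
    and "prob_space \<rho>"
    and "sets \<rho> = sets (restrict_space borel \<Xi>)"
    and "(\<lambda>\<xi> x. u\<^sub>0 x \<xi>) \<in> bochner_Linf \<rho> lebesgue"
    and "\<And>w. (\<lambda>\<xi>. f w \<xi>) \<in> borel_measurable (completion \<rho>)"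
    and "\<And>K. compact K \<Longrightarrow> \<exists>C::real. \<forall>w\<in>K. AE \<xi> in \<rho>. norm (f w \<xi>) \<le> C"
    and "AE \<xi> in \<rho>. (\<lambda>w. f w \<xi>) C1_differentiable_on UNIV"
    and "bochner_measurable \<rho> (lebesgue_on half_space) (\<lambda>\<xi> (t, x). u t x \<xi>)"
  shows "parametric_entropy_solution \<rho> (kruzhkov_family f) u\<^sub>0 u \<longleftrightarrow>
    weak_parametric_entropy_solution \<rho> (kruzhkov_family f) u\<^sub>0 u"
proof -
  obtain g where fg: "AE \<xi> in \<rho>. \<forall>y. g y \<xi> = f y \<xi>"
    and gC1: "\<And>\<xi>. (\<lambda>y. g y \<xi>) C1_differentiable_on UNIV"
    and gm: "\<And>y. g y \<in> borel_measurable \<rho>"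
    and gb: "\<And>r. \<exists>C. \<forall>y \<xi>. \<bar>y\<bar> \<le> r \<longrightarrow> norm (g y \<xi>) \<le> C"
    using flux_version[OF assms(5-7)] by blast
  have gmeas: "(\<lambda>(y, \<xi>). g y \<xi>) \<in> borel_measurable (borel \<Otimes>\<^sub>M \<rho>)"
    by (intro caratheodory_measurable C1_differentiable_imp_continuous_on gC1 gm)
  obtain V where V: "(\<lambda>(z, \<xi>). V z \<xi>) \<in> borel_measurable (lborel \<Otimes>\<^sub>M \<rho>)"
    and Vu: "AE \<xi> in \<rho>. AE z in lebesgue_on half_space. V z \<xi> = (\<lambda>(t, x). u t x \<xi>) z"
    by (rule bochner_measurable_version[OF assms(8) half_space_borel])
  have bu0: "bochner_measurable \<rho> (lebesgue_on UNIV) (\<lambda>\<xi> x. u\<^sub>0 x \<xi>)"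
    using assms(4) by (simp add: bochner_Linf_def lebesgue_on_UNIV_eq)
  obtain V0 where V0: "(\<lambda>(x, \<xi>). V0 x \<xi>) \<in> borel_measurable (lborel \<Otimes>\<^sub>M \<rho>)"
    and V0u: "AE \<xi> in \<rho>. AE x in lebesgue_on UNIV. V0 x \<xi> = u\<^sub>0 x \<xi>"
    by (rule bochner_measurable_version[OF bu0]) simp
  obtain M where M: "AE \<xi> in \<rho>. Linf_norm lebesgue (\<lambda>x. u\<^sub>0 x \<xi>) \<le> ereal M"
    using assms(4) by (auto simp: bochner_Linf_def)
  define clip where "clip K y = max (- \<bar>K\<bar>) (min \<bar>K\<bar> y)" for K y :: real
  have clip: "\<bar>clip K y\<bar> \<le> \<bar>K\<bar>" "\<bar>y\<bar> \<le> K \<Longrightarrow> clip K y = y" for K y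
    by (auto simp: clip_def)
  have clip_meas: "clip K \<in> borel_measurable borel" for K unfolding clip_def by measurable
  define w0 where "w0 x \<xi> = clip M (V0 x \<xi>)" for x \<xi>
  have w0: "(\<lambda>(x, \<xi>). w0 x \<xi>) \<in> borel_measurable (lborel \<Otimes>\<^sub>M \<rho>)"
    using measurable_compose[OF V0 clip_meas[of M]] by (simp add: w0_def case_prod_beta)
  have w0_bound: "\<bar>w0 x \<xi>\<bar> \<le> \<bar>M\<bar>" for x \<xi> unfolding w0_def by (rule clip)
  have "AE \<xi> in \<rho>. AE x in lebesgue. w0 x \<xi> = u\<^sub>0 x \<xi>"
    using V0u[unfolded lebesgue_on_UNIV_eq] M
  proof eventually_elim
    case (elim \<xi>)
    have "AE x in lebesgue. ereal \<bar>u\<^sub>0 x \<xi>\<bar> \<le> ereal M"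
      by (rule eventually_mono[OF esssup_AE[of "\<lambda>x. ereal \<bar>u\<^sub>0 x \<xi>\<bar>" lebesgue]])
        (rule order_trans[OF _ elim(2)[unfolded Linf_norm_def]])
    then show ?case using elim(1) by eventually_elim (simp add: w0_def clip(2))
  qed
  then have ver0: "is_version \<rho> lebesgue (\<lambda>\<xi> x. u\<^sub>0 x \<xi>) (\<lambda>\<xi> x. w0 x \<xi>)"
    by (simp add: is_version_def)
  have verV: "is_version \<rho> (lebesgue_on half_space) (\<lambda>\<xi> (t, x). u t x \<xi>) (\<lambda>\<xi> (t, x). V (t, x) \<xi>)"
    using Vu by (simp add: is_version_def case_prod_beta)
  have gf: "AE \<xi> in \<rho>. \<forall>y. f y \<xi> = g y \<xi>" using fg by eventually_elim simp
  have id: "(\<lambda>p. p) \<in> lebesgue_on half_space \<Otimes>\<^sub>M \<rho> \<rightarrow>\<^sub>M (lborel :: (real \<times> (real ^ 'n)) measure) \<Otimes>\<^sub>M \<rho>"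
    using measurable_Pair[OF measurable_compose[OF measurable_fst] measurable_snd,
      of "\<lambda>z. z" "lebesgue_on half_space" lborel \<rho>]
    by (simp add: measurable_restrict_space1 measurable_completion)
  have id0: "(\<lambda>p. p) \<in> lebesgue \<Otimes>\<^sub>M \<rho> \<rightarrow>\<^sub>M (lborel :: (real ^ 'n) measure) \<Otimes>\<^sub>M \<rho>"
    using measurable_Pair[OF measurable_compose[OF measurable_fst] measurable_snd,
      of "\<lambda>z. z" lebesgue lborel \<rho>] by (simp add: measurable_completion)
  have w0_joint: "(\<lambda>(x, \<xi>). w0 x \<xi>) \<in> borel_measurable (completion (lebesgue \<Otimes>\<^sub>M \<rho>))"
    using measurable_completion[OF measurable_compose[OF id0 w0]] .
  have joint: "(\<lambda>((t, x), \<xi>). w (t, x) \<xi>) \<in> borel_measurable (completion (lebesgue_on half_space \<Otimes>\<^sub>M \<rho>))"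
    if "(\<lambda>(z, \<xi>). w z \<xi>) \<in> borel_measurable (lborel \<Otimes>\<^sub>M \<rho>)" for w :: "real \<times> (real ^ 'n) \<Rightarrow> real ^ 'p \<Rightarrow> real"
    using measurable_completion[OF measurable_compose[OF id that]] by (simp add: case_prod_beta)
  have rep_iff: "weak_parametric_entropy_solution \<rho> (kruzhkov_family g) w0 (\<lambda>t x. w (t, x)) \<longleftrightarrow>
      weak_parametric_entropy_solution_rep \<rho> (kruzhkov_family g) w0 (\<lambda>t x. w (t, x))"
    if "(\<lambda>(z, \<xi>). w z \<xi>) \<in> borel_measurable (lborel \<Otimes>\<^sub>M \<rho>)" for w
    by (rule weak_parametric_entropy_solution_iff_rep[OF assms(2) joint[OF that] w0_joint])
  \<comment> \<open>If the version \<open>V\<close> of the state is bounded uniformly in the parameter, truncation gives a version that is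
    bounded everywhere, as \<open>bounded_data\<close> requires.\<close>
  have main: "parametric_entropy_solution \<rho> (kruzhkov_family f) u\<^sub>0 u \<longleftrightarrow>
      weak_parametric_entropy_solution \<rho> (kruzhkov_family f) u\<^sub>0 u"
    if bound: "AE \<xi> in \<rho>. AE z in lebesgue_on half_space. \<bar>V z \<xi>\<bar> \<le> C" for C
  proof -
    define K where "K = max \<bar>M\<bar> C"
    define w where "w z \<xi> = clip K (V z \<xi>)" for z \<xi>
    have K: "\<bar>K\<bar> = K" by (auto simp: K_def)
    have wm: "(\<lambda>(z, \<xi>). w z \<xi>) \<in> borel_measurable (lborel \<Otimes>\<^sub>M \<rho>)"
      using measurable_compose[OF V clip_meas[of K]] by (simp add: w_def case_prod_beta)
    interpret bounded_data \<Xi> \<rho> g w w0 K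
    proof (rule bounded_data.intro)
      show "\<bar>w z \<xi>\<bar> \<le> K" for z \<xi> using clip(1)[of K] K by (simp add: w_def)
      show "\<bar>w0 x \<xi>\<bar> \<le> K" for x \<xi> using w0_bound[of x \<xi>] by (simp add: K_def)
    qed (fact assms(1-3) gmeas gb wm w0)+
    have "AE \<xi> in \<rho>. AE z in lebesgue_on half_space. (\<lambda>(t, x). w (t, x) \<xi>) z = (\<lambda>(t, x). V (t, x) \<xi>) z"
      using bound
    proof eventually_elim
      case (elim \<xi>)
      then show ?case by eventually_elim (auto simp: w_def K_def intro!: clip(2))
    qed
    then have "is_version \<rho> (lebesgue_on half_space) (\<lambda>\<xi> (t, x). V (t, x) \<xi>) (\<lambda>\<xi> (t, x). w (t, x) \<xi>)"
      by (simp add: is_version_def)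
    note ver = is_version_trans[OF verV this]
    have "parametric_entropy_solution \<rho> (kruzhkov_family f) u\<^sub>0 u \<longleftrightarrow>
        parametric_entropy_solution \<rho> (kruzhkov_family g) w0 (\<lambda>t x. w (t, x))"
      using parametric_entropy_solution_version[OF _ fg ver ver0]
        parametric_entropy_solution_version[OF _ gf is_version_sym[OF ver] is_version_sym[OF ver0]] by blast
    also have "\<dots> \<longleftrightarrow> weak_parametric_entropy_solution \<rho> (kruzhkov_family g) w0 (\<lambda>t x. w (t, x))"
      unfolding rep_iff[OF wm] by (rule parametric_iff_weak_rep)
    also have "\<dots> \<longleftrightarrow> weak_parametric_entropy_solution \<rho> (kruzhkov_family f) u\<^sub>0 u"
      using weak_parametric_entropy_solution_version[OF _ fg ver ver0]
        weak_parametric_entropy_solution_version[OF _ gf is_version_sym[OF ver] is_version_sym[OF ver0]] by blast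
    finally show ?thesis .
  qed
  show ?thesis
  proof
    assume sol: "parametric_entropy_solution \<rho> (kruzhkov_family f) u\<^sub>0 u"
    have "AE \<xi> in \<rho>. AE z in lebesgue_on half_space. \<bar>V z \<xi>\<bar> \<le> \<bar>M\<bar>"
    proof (rule parametric_entropy_solution_bound[OF _ gC1])
      show "parametric_entropy_solution \<rho> (kruzhkov_family g) w0 (\<lambda>t x. V (t, x))"
        by (rule parametric_entropy_solution_version[OF sol fg verV ver0])
      show "(\<lambda>z. V z \<xi>) \<in> borel_measurable borel" if "\<xi> \<in> space \<rho>" for \<xi>
        using measurable_compose[OF measurable_Pair2'[OF that] V] by simp
      show "(\<lambda>x. w0 x \<xi>) \<in> borel_measurable borel" if "\<xi> \<in> space \<rho>" for \<xi>
        using measurable_compose[OF measurable_Pair2'[OF that] w0] by simp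
    qed (rule w0_bound)
    from main[OF this] sol show "weak_parametric_entropy_solution \<rho> (kruzhkov_family f) u\<^sub>0 u" by blast
  next
    assume sol: "weak_parametric_entropy_solution \<rho> (kruzhkov_family f) u\<^sub>0 u"
    have "weak_parametric_entropy_solution_rep \<rho> (kruzhkov_family g) w0 (\<lambda>t x. V (t, x))"
      using weak_parametric_entropy_solution_version[OF sol fg verV ver0] unfolding rep_iff[OF V] .
    then obtain C where "AE \<xi> in \<rho>. AE z in lebesgue_on half_space. \<bar>V z \<xi>\<bar> \<le> C"
      using weak_rep_bound[OF assms(2)] by blast
    from main[OF this] sol show "parametric_entropy_solution \<rho> (kruzhkov_family f) u\<^sub>0 u" by blast
  qed
qed

end
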